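(* Let $H$ be a complex Hilbert space and let $\phi:B_s(H)\to B_s(H)$ be a bijective (real-)linear map which preserves the maximal deviation, that is, suppose that \[ \|\phi(A)\|_v=\|A\|_v \qquad (A\in B_s(H)). \] Then there exist an either unitary or antiunitary operator $U$ on $H$ and a linear functional $f:B_s(H)\to\mathbb R$ such that $\phi$ is either of the form \[ \phi(A)=UAU^*+f(A)I \qquad (A\in B_s(H)) \] or of the form \[ \phi(A)=-UAU^*+f(A)I \qquad (A\in B_s(H)). \]
   Context: $B_s(H)$ denotes the real vector space of all self-adjoint bounded linear operators on the complex Hilbert space $H$, and $I$ is the identity operator. For $A\in B_s(H)$ and a unit vector $\varphi\in H$, the variance of $A$ in the state $\varphi$ is $var(A,\varphi)=\langle A^2\varphi,\varphi\rangle-\langle A\varphi,\varphi\rangle^2$. The maximal deviation of $A$ is $\|A\|_v=\sup_{\|\varphi\|=1} var(A,\varphi)^{1/2}$. An antiunitary operator is a norm preserving conjugate-linear bijection $U$ of $H$; for unitary or antiunitary $U$ one has $U^*=U^{-1}$. The functional $f$ is not required to be continuous. *)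

theory Defs
  imports "HOL-Analysis.Analysis"
begin

(* The complex inner product is linear in its first argument. Its real part is the inner
   product of the underlying real inner product space, so the norm is x |-> sqrt <x,x>
   and definiteness of the complex inner product is inherited. *)
class complex_inner_space = real_inner +
  fixes scaleC :: "complex \<Rightarrow> 'a \<Rightarrow> 'a"  (infixr "*\<^sub>C" 75)
    and cinner :: "'a \<Rightarrow> 'a \<Rightarrow> complex"
  assumes scaleR_eq_scaleC: "r *\<^sub>R x = complex_of_real r *\<^sub>C x"
    and scaleC_add_right: "c *\<^sub>C (x + y) = c *\<^sub>C x + c *\<^sub>C y"
    and scaleC_add_left: "(c + d) *\<^sub>C x = c *\<^sub>C x + d *\<^sub>C x"
    and scaleC_scaleC: "c *\<^sub>C (d *\<^sub>C x) = (c * d) *\<^sub>C x"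
    and cinner_commute: "cinner x y = cnj (cinner y x)"
    and cinner_add_left: "cinner (x + y) z = cinner x z + cinner y z"
    and cinner_scaleC_left: "cinner (c *\<^sub>C x) y = c * cinner x y"
    and inner_eq_Re_cinner: "x \<bullet> y = Re (cinner x y)"

class complex_hilbert_space = complex_inner_space + complete_space

instantiation complex :: complex_hilbert_space
begin
definition scaleC_complex :: "complex \<Rightarrow> complex \<Rightarrow> complex"
  where "scaleC_complex c z = c * z"
definition cinner_complex :: "complex \<Rightarrow> complex \<Rightarrow> complex"
  where "cinner_complex z w = z * cnj w"
instance
  by standard
    (auto simp: scaleC_complex_def cinner_complex_def scaleR_conv_of_real algebra_simps
      inner_complex_def)
end

instantiation vec :: (complex_inner_space, finite) complex_inner_space
begin
definition scaleC_vec :: "complex \<Rightarrow> 'a ^ 'b \<Rightarrow> 'a ^ 'b"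
  where "scaleC_vec c v = (\<chi> i. c *\<^sub>C v $ i)"
definition cinner_vec :: "'a ^ 'b \<Rightarrow> 'a ^ 'b \<Rightarrow> complex"
  where "cinner_vec v w = (\<Sum>i\<in>UNIV. cinner (v $ i) (w $ i))"
instance
proof
  fix v w :: "'a ^ 'b"
  show "cinner v w = cnj (cinner w v)"
    unfolding cinner_vec_def cnj_sum by (rule sum.cong) (auto intro: cinner_commute)
qed (auto simp: scaleC_vec_def cinner_vec_def vec_eq_iff scaleR_eq_scaleC scaleC_add_right
      scaleC_add_left scaleC_scaleC cinner_add_left cinner_scaleC_left sum.distrib
      sum_distrib_left inner_vec_def inner_eq_Re_cinner)
end

instance vec :: (complex_hilbert_space, finite) complex_hilbert_space ..

lemma complex_inner_space_basics:
  fixes x y z :: "'a::complex_inner_space"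
  shows scaleC_one: "1 *\<^sub>C x = x"
    and cinner_add_right: "cinner x (y + z) = cinner x y + cinner x z"
    and cinner_scaleC_right: "cinner x (c *\<^sub>C y) = cnj c * cinner x y"
    and cinner_self: "cinner x x = complex_of_real ((norm x)\<^sup>2)"
proof -
  show "1 *\<^sub>C x = x"
    using scaleR_eq_scaleC[of 1 x] by simp
  show "cinner x (y + z) = cinner x y + cinner x z"
    by (metis cinner_add_left cinner_commute complex_cnj_add)
  show "cinner x (c *\<^sub>C y) = cnj c * cinner x y"
    by (metis cinner_commute cinner_scaleC_left complex_cnj_mult)
  have "Im (cinner x x) = 0"
    using arg_cong[OF cinner_commute[of x x], of Im] by simp
  then show "cinner x x = complex_of_real ((norm x)\<^sup>2)"
    by (simp add: complex_eq_iff power2_norm_eq_inner inner_eq_Re_cinner)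
qed

lemma Im_cinner: "Im (cinner x y) = - ((\<i> *\<^sub>C x) \<bullet> y)"
  by (simp add: inner_eq_Re_cinner cinner_scaleC_left)

definition selfadjoint_ops :: "('a::complex_hilbert_space \<Rightarrow>\<^sub>L 'a) set"
  where "selfadjoint_ops =
    {A :: 'a \<Rightarrow>\<^sub>L 'a. (\<forall>c x. A (c *\<^sub>C x) = c *\<^sub>C A x) \<and> (\<forall>x y. cinner (A x) y = cinner x (A y))}"

lemma subspace_selfadjoint_ops: "subspace selfadjoint_ops"
proof -
  have *: "cinner 0 x = 0" "cinner x 0 = 0" "c *\<^sub>C (0::'a) = 0" for x :: 'a and c
    using cinner_add_left[of 0 0 x] cinner_add_right[of x 0 0] scaleC_add_right[of c 0 0]
    by simp_all
  show ?thesis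
    by (auto simp: subspace_def selfadjoint_ops_def * blinfun.add_left blinfun.scaleR_left
        cinner_add_left cinner_add_right scaleC_add_right scaleR_eq_scaleC cinner_scaleC_left
        cinner_scaleC_right scaleC_scaleC mult.commute)
qed

definition real_linear_on :: "'b::real_vector set \<Rightarrow> ('b \<Rightarrow> 'c::real_vector) \<Rightarrow> bool"
  where "real_linear_on V g \<longleftrightarrow>
    (\<forall>A\<in>V. \<forall>B\<in>V. g (A + B) = g A + g B) \<and> (\<forall>r. \<forall>A\<in>V. g (r *\<^sub>R A) = r *\<^sub>R g A)"

(* For self-adjoint A both inner products are real, so Re only changes the type. *)
definition variance_at :: "('a::complex_hilbert_space \<Rightarrow>\<^sub>L 'a) \<Rightarrow> 'a \<Rightarrow> real"
  where "variance_at A x = Re (cinner (A (A x)) x) - (Re (cinner (A x) x))\<^sup>2"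

definition max_deviation :: "('a::complex_hilbert_space \<Rightarrow>\<^sub>L 'a) \<Rightarrow> real"
  where "max_deviation A = (SUP x\<in>{x. norm x = 1}. sqrt (variance_at A x))"

lemma bdd_above_deviation:
  fixes A :: "'a::complex_hilbert_space \<Rightarrow>\<^sub>L 'a"
  shows "bdd_above ((\<lambda>x. sqrt (variance_at A x)) ` {x. norm x = 1})"
proof (rule bdd_aboveI2)
  fix x :: 'a
  assume "x \<in> {x. norm x = 1}"
  then have x: "norm x = 1" by simp
  have "Re (cinner (A (A x)) x) \<le> norm (A (A x))"
    using norm_cauchy_schwarz[of "A (A x)" x] x by (simp add: inner_eq_Re_cinner)
  also have "\<dots> \<le> norm A * norm (A x)"
    by (rule norm_blinfun)
  also have "\<dots> \<le> norm A * norm A"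
    using norm_blinfun[of A x] x by (intro mult_left_mono) auto
  finally have "variance_at A x \<le> (norm A)\<^sup>2"
    unfolding variance_at_def by (smt (verit) power2_eq_square zero_le_power2)
  then show "sqrt (variance_at A x) \<le> norm A"
    using real_sqrt_le_mono by fastforce
qed

definition unitary_op :: "('a::complex_hilbert_space \<Rightarrow> 'a) \<Rightarrow> bool"
  where "unitary_op U \<longleftrightarrow> (\<forall>x y. U (x + y) = U x + U y) \<and> (\<forall>c x. U (c *\<^sub>C x) = c *\<^sub>C U x)
    \<and> (\<forall>x. norm (U x) = norm x) \<and> bij U"

definition antiunitary_op :: "('a::complex_hilbert_space \<Rightarrow> 'a) \<Rightarrow> bool"
  where "antiunitary_op U \<longleftrightarrow> (\<forall>x y. U (x + y) = U x + U y) \<and> (\<forall>c x. U (c *\<^sub>C x) = cnj c *\<^sub>C U x)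
    \<and> (\<forall>x. norm (U x) = norm x) \<and> bij U"

lemma inner_isometry:
  fixes U :: "'a::real_inner \<Rightarrow> 'a"
  assumes "\<And>x y. U (x + y) = U x + U y" and "\<And>x. norm (U x) = norm x"
  shows "U x \<bullet> U y = x \<bullet> y"
  using assms(2)[of "x + y"] assms(2)[of x] assms(2)[of y]
  by (simp add: assms(1) norm_eq_sqrt_inner inner_add_left inner_add_right inner_commute)

(* The inverse of a unitary or antiunitary operator is its adjoint; this is why
   inv U stands for the adjoint of U. *)
lemma unitary_op_adjoint:
  assumes "unitary_op U"
  shows "cinner (U x) y = cinner x (inv U y)"
proof -
  have U: "U (inv U y) = y"
    using assms by (simp add: unitary_op_def bij_is_surj surj_f_inv_f)
  have iso: "U u \<bullet> U v = u \<bullet> v" for u v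
    using assms by (intro inner_isometry) (auto simp: unitary_op_def)
  have "\<i> *\<^sub>C U x = U (\<i> *\<^sub>C x)"
    using assms by (simp add: unitary_op_def)
  then have "cinner (U x) (U v) = cinner x v" for v
    using iso[of x v] iso[of "\<i> *\<^sub>C x" v]
    by (simp add: complex_eq_iff Im_cinner flip: inner_eq_Re_cinner)
  from this[of "inv U y"] show ?thesis
    by (simp add: U)
qed

lemma antiunitary_op_adjoint:
  assumes "antiunitary_op U"
  shows "cinner (U x) y = cnj (cinner x (inv U y))"
proof -
  have U: "U (inv U y) = y"
    using assms by (simp add: antiunitary_op_def bij_is_surj surj_f_inv_f)
  have iso: "U u \<bullet> U v = u \<bullet> v" for u v
    using assms by (intro inner_isometry) (auto simp: antiunitary_op_def)
  have "(- \<i>) *\<^sub>C U x = U (\<i> *\<^sub>C x)"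
    using assms by (simp add: antiunitary_op_def)
  moreover have "(- \<i>) *\<^sub>C u = - (\<i> *\<^sub>C u)" for u :: 'a
    using scaleC_scaleC[of "-1" "\<i>" u] scaleR_eq_scaleC[of "-1" "\<i> *\<^sub>C u"] by simp
  ultimately have i: "\<i> *\<^sub>C U x = - U (\<i> *\<^sub>C x)"
    by (metis minus_minus)
  have "cinner (U x) (U v) = cnj (cinner x v)" for v
    using iso[of x v] iso[of "\<i> *\<^sub>C x" v]
    by (simp add: complex_eq_iff Im_cinner i flip: inner_eq_Re_cinner)
  from this[of "inv U y"] show ?thesis
    by (simp add: U)
qed

end

theory Submission
  imports Defs
begin

text \<open>Write \<open>q\<^sub>A(u) = \<langle>A u, u\<rangle>\<close>. The maximal deviation of \<open>A\<close> is half the oscillation of \<open>q\<^sub>A\<close> on the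
  unit sphere, so \<open>\<phi>\<close> induces a linear isometry of the self-adjoint operators modulo scalars. The
  extreme points of the unit ball of this quotient are the classes of the nontrivial projections
  \<open>R\<close>. The operators \<open>B\<close> that are off-diagonal with respect to \<open>R\<close> are recognised by the oscillation
  of \<open>t R \<plusminus> B\<close> being \<open>t + O(1/t)\<close>, and they satisfy the parallelogram law only if \<open>R\<close> or \<open>I - R\<close>
  has rank one. Hence, after possibly replacing \<open>\<phi>\<close> by \<open>- \<phi>\<close>, the projection onto a unit vector
  \<open>e\<close> goes to a projection onto a unit vector \<open>e'\<close> plus a scalar, and the operators off-diagonal
  to these, which correspond to the vectors orthogonal to \<open>e\<close> and \<open>e'\<close>, are mapped by a real-linear
  isometry \<open>W\<close>. It turns out to be linear or conjugate-linear and extends to the required \<open>U\<close> by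
  \<open>e \<mapsto> e'\<close>. Finally, a general \<open>A\<close> is determined modulo scalars by the oscillations of
  \<open>A + t (P\<^sub>x - P\<^sub>y)\<close> for large \<open>t\<close>, where \<open>P\<^sub>x, P\<^sub>y\<close> are projections onto orthonormal \<open>x, y\<close>.\<close>

subsection \<open>Complex inner product spaces\<close>

lemma scaleC_zero_left [simp]: "0 *\<^sub>C x = (0::'a::complex_inner_space)"
  using scaleR_eq_scaleC[of 0 x] by simp

lemma scaleC_zero_right [simp]: "c *\<^sub>C (0::'a::complex_inner_space) = 0"
  using scaleC_add_right[of c 0 0] by simp

lemma scaleC_minus_left [simp]: "(- c) *\<^sub>C x = - (c *\<^sub>C (x::'a::complex_inner_space))"
  using scaleC_add_left[of "-c" c x] by (simp add: eq_neg_iff_add_eq_0)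

lemma scaleC_minus_right [simp]: "c *\<^sub>C (- x) = - (c *\<^sub>C (x::'a::complex_inner_space))"
  using scaleC_add_right[of c "-x" x] by (simp add: eq_neg_iff_add_eq_0)

lemma scaleC_diff_left: "(c - d) *\<^sub>C x = c *\<^sub>C x - d *\<^sub>C (x::'a::complex_inner_space)"
  using scaleC_add_left[of c "-d" x] by simp

lemma scaleC_diff_right: "c *\<^sub>C (x - y) = c *\<^sub>C x - c *\<^sub>C (y::'a::complex_inner_space)"
  using scaleC_add_right[of c x "-y"] by simp

lemma scaleC_scaleR: "c *\<^sub>C (r *\<^sub>R x) = r *\<^sub>R (c *\<^sub>C (x::'a::complex_inner_space))"
  by (simp add: scaleR_eq_scaleC scaleC_scaleC mult.commute)

lemma cinner_zero_left [simp]: "cinner 0 (x::'a::complex_inner_space) = 0"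
  using cinner_add_left[of 0 0 x] by simp

lemma cinner_zero_right [simp]: "cinner (x::'a::complex_inner_space) 0 = 0"
  using cinner_add_right[of x 0 0] by simp

lemma cinner_minus_left [simp]: "cinner (- x) y = - cinner x (y::'a::complex_inner_space)"
  using cinner_add_left[of "-x" x y] by (simp add: eq_neg_iff_add_eq_0)

lemma cinner_minus_right [simp]: "cinner x (- y) = - cinner x (y::'a::complex_inner_space)"
  using cinner_add_right[of x "-y" y] by (simp add: eq_neg_iff_add_eq_0)

lemma cinner_diff_left: "cinner (x - y) z = cinner x z - cinner y (z::'a::complex_inner_space)"
  using cinner_add_left[of x "-y" z] by simp

lemma cinner_diff_right: "cinner x (y - z) = cinner x y - cinner x (z::'a::complex_inner_space)"
  using cinner_add_right[of x y "-z"] by simp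

lemma cinner_scaleR_left [simp]:
  "cinner (r *\<^sub>R x) y = complex_of_real r * cinner x (y::'a::complex_inner_space)"
  by (simp add: scaleR_eq_scaleC cinner_scaleC_left)

lemma cinner_scaleR_right [simp]:
  "cinner x (r *\<^sub>R y) = complex_of_real r * cinner x (y::'a::complex_inner_space)"
  by (simp add: scaleR_eq_scaleC cinner_scaleC_right)

lemmas cinner_bilinear = cinner_add_left cinner_add_right cinner_diff_left cinner_diff_right
  cinner_scaleC_left cinner_scaleC_right

lemma cinner_eq_zero_commute: "cinner x y = 0 \<longleftrightarrow> cinner y (x::'a::complex_inner_space) = 0"
  by (metis cinner_commute complex_cnj_zero_iff)

lemma cmod_cinner_commute: "cmod (cinner x y) = cmod (cinner y (x::'a::complex_inner_space))"
  by (metis cinner_commute complex_mod_cnj)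

lemma cinner_self_eq_zero [simp]: "cinner x x = 0 \<longleftrightarrow> (x::'a::complex_inner_space) = 0"
  by (simp add: cinner_self)

lemma norm_scaleC [simp]: "norm (c *\<^sub>C x) = cmod c * norm (x::'a::complex_inner_space)"
proof -
  have "cinner (c *\<^sub>C x) (c *\<^sub>C x) = complex_of_real ((cmod c * norm x)\<^sup>2)"
    using complex_norm_square[of c] cinner_self[of x]
    by (simp add: cinner_scaleC_left cinner_scaleC_right power_mult_distrib mult.assoc[symmetric])
  then have "(norm (c *\<^sub>C x))\<^sup>2 = (cmod c * norm x)\<^sup>2"
    unfolding cinner_self using of_real_eq_iff by blast
  then show ?thesis
    by simp
qed

text \<open>A phase changes neither norms nor quadratic forms of self-adjoint operators, so
  arguments about a pair of vectors may assume that their inner product is real and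
  nonnegative.\<close>

lemma exists_phase:
  fixes u v :: "'a::complex_inner_space"
  obtains \<theta> where "cmod \<theta> = 1" "cinner (\<theta> *\<^sub>C u) v = complex_of_real (cmod (cinner u v))"
proof (cases "cinner u v = 0")
  case True
  then show ?thesis
    using that[of 1] by (simp add: cinner_scaleC_left)
next
  case False
  define \<theta> where "\<theta> = cnj (cinner u v) / complex_of_real (cmod (cinner u v))"
  have "cmod \<theta> = 1"
    using False by (simp add: \<theta>_def norm_divide)
  moreover have "\<theta> * cinner u v = complex_of_real (cmod (cinner u v))"
    using False complex_norm_square[of "cinner u v"]
    by (simp add: \<theta>_def power2_eq_square field_simps)
  ultimately show ?thesis
    using that by (simp add: cinner_scaleC_left)
qed

lemma cmod_cinner_le: "cmod (cinner u v) \<le> norm u * norm (v::'a::complex_inner_space)"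
proof -
  obtain \<theta> where \<theta>: "cmod \<theta> = 1" "cinner (\<theta> *\<^sub>C u) v = complex_of_real (cmod (cinner u v))"
    by (rule exists_phase)
  have "cmod (cinner u v) = (\<theta> *\<^sub>C u) \<bullet> v"
    using \<theta>(2) by (simp add: inner_eq_Re_cinner)
  also have "\<dots> \<le> norm u * norm v"
    using norm_cauchy_schwarz[of "\<theta> *\<^sub>C u" v] \<theta>(1) by simp
  finally show ?thesis .
qed

lemma norm_add_orthogonal:
  fixes x y :: "'a::complex_inner_space"
  assumes "cinner x y = 0"
  shows "(norm (x + y))\<^sup>2 = (norm x)\<^sup>2 + (norm y)\<^sup>2"
proof -
  have "x \<bullet> y = 0"
    using assms by (simp add: inner_eq_Re_cinner)
  then show ?thesis
    by (simp add: power2_norm_eq_inner inner_add_left inner_add_right inner_commute)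
qed

lemma norm_diff_component:
  fixes u e :: "'a::complex_inner_space"
  assumes "norm e = 1"
  shows "cinner (u - cinner u e *\<^sub>C e) e = 0"
    and "(norm (u - cinner u e *\<^sub>C e))\<^sup>2 = (norm u)\<^sup>2 - (cmod (cinner u e))\<^sup>2"
proof -
  show *: "cinner (u - cinner u e *\<^sub>C e) e = 0"
    using assms by (simp add: cinner_bilinear cinner_self)
  have "cinner (u - cinner u e *\<^sub>C e) (cinner u e *\<^sub>C e) = 0"
    using * by (simp add: cinner_scaleC_right)
  from norm_add_orthogonal[OF this]
  show "(norm (u - cinner u e *\<^sub>C e))\<^sup>2 = (norm u)\<^sup>2 - (cmod (cinner u e))\<^sup>2"
    using assms by simp
qed

text \<open>The component along the new vector is split off. The remaining coefficients do not
  change, and the induction hypothesis is applied to the remainder \<open>u'\<close>; hence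
  \<open>u\<close> is kept arbitrary.\<close>

lemma bessel_inequality:
  fixes u :: "'a::complex_inner_space"
  assumes "finite X" "\<And>x. x \<in> X \<Longrightarrow> norm x = 1"
    and "\<And>x y. x \<in> X \<Longrightarrow> y \<in> X \<Longrightarrow> x \<noteq> y \<Longrightarrow> cinner x y = 0"
  shows "(\<Sum>x\<in>X. (cmod (cinner u x))\<^sup>2) \<le> (norm u)\<^sup>2"
  using assms
proof (induction X arbitrary: u rule: finite_induct)
  case empty
  then show ?case by simp
next
  case (insert e X)
  define u' where "u' = u - cinner u e *\<^sub>C e"
  have "cinner u' x = cinner u x" if "x \<in> X" for x
  proof -
    have "cinner e x = 0"
      using insert.prems(2)[of e x] insert.hyps that by auto
    then show ?thesis
      by (simp add: u'_def cinner_bilinear)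
  qed
  then have "(\<Sum>x\<in>X. (cmod (cinner u x))\<^sup>2) = (\<Sum>x\<in>X. (cmod (cinner u' x))\<^sup>2)"
    by simp
  also have "\<dots> \<le> (norm u')\<^sup>2"
    using insert by auto
  also have "\<dots> = (norm u)\<^sup>2 - (cmod (cinner u e))\<^sup>2"
    using norm_diff_component(2)[of e u] insert.prems by (simp add: u'_def)
  finally show ?case
    using insert.hyps by simp
qed

definition orthonormal_pair :: "'a::complex_inner_space \<Rightarrow> 'a \<Rightarrow> bool"
  where "orthonormal_pair x y \<longleftrightarrow> norm x = 1 \<and> norm y = 1 \<and> cinner x y = 0"

subsection \<open>Maximal deviation and oscillation of the quadratic form\<close>

text \<open>A bound on the diameter of the numerical range. As a predicate in \<open>r\<close> it
  needs no boundedness or nonemptiness argument, unlike a supremum.\<close>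

definition spread_le :: "('a::complex_hilbert_space \<Rightarrow>\<^sub>L 'a) \<Rightarrow> real \<Rightarrow> bool"
  where "spread_le A r \<longleftrightarrow> (\<forall>u v. norm u = 1 \<longrightarrow> norm v = 1 \<longrightarrow> A u \<bullet> u - A v \<bullet> v \<le> r)"

lemma spread_leI:
  fixes A :: "'a::complex_hilbert_space \<Rightarrow>\<^sub>L 'a"
  shows
  "(\<And>u v. norm u = 1 \<Longrightarrow> norm v = 1 \<Longrightarrow> A u \<bullet> u - A v \<bullet> v \<le> r) \<Longrightarrow> spread_le A r"
  by (simp add: spread_le_def)

lemma spread_leD:
  fixes A :: "'a::complex_hilbert_space \<Rightarrow>\<^sub>L 'a"
  shows "spread_le A r \<Longrightarrow> norm u = 1 \<Longrightarrow> norm v = 1 \<Longrightarrow> A u \<bullet> u - A v \<bullet> v \<le> r"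
  by (simp add: spread_le_def)

lemma spread_le_bounds:
  fixes A :: "'a::complex_hilbert_space \<Rightarrow>\<^sub>L 'a"
  assumes "\<And>u. norm u = 1 \<Longrightarrow> a \<le> A u \<bullet> u" "\<And>u. norm u = 1 \<Longrightarrow> A u \<bullet> u \<le> b"
  shows "spread_le A (b - a)"
  using assms by (force simp: spread_le_def intro: diff_mono)

lemma selfadjoint_cinner: "A \<in> selfadjoint_ops \<Longrightarrow> cinner (A x) y = cinner x (A y)"
  by (simp add: selfadjoint_ops_def)

lemma selfadjoint_scaleC: "A \<in> selfadjoint_ops \<Longrightarrow> A (c *\<^sub>C x) = c *\<^sub>C A x"
  by (simp add: selfadjoint_ops_def)

lemma selfadjoint_inner: "A \<in> selfadjoint_ops \<Longrightarrow> A x \<bullet> y = x \<bullet> A y"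
  by (simp add: selfadjoint_cinner inner_eq_Re_cinner)

lemma selfadjoint_cinner_self:
  "A \<in> selfadjoint_ops \<Longrightarrow> cinner (A x) x = complex_of_real (A x \<bullet> x)"
proof -
  assume "A \<in> selfadjoint_ops"
  then have "cinner (A x) x = cnj (cinner (A x) x)"
    by (metis cinner_commute selfadjoint_cinner)
  then have "Im (cinner (A x) x) = 0"
    by (metis Reals_cnj_iff complex_is_Real_iff)
  then show ?thesis
    by (simp add: complex_eq_iff inner_eq_Re_cinner)
qed

text \<open>The mixed terms cancel because the real form is symmetric. A difference of diagonal
  values thus becomes a single off-diagonal one.\<close>

lemma selfadjoint_polarization:
  assumes "A \<in> selfadjoint_ops"
  shows "A u \<bullet> u - A v \<bullet> v = A (u + v) \<bullet> (u - v)"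
  using selfadjoint_inner[OF assms, of u v]
  by (simp add: blinfun.add_right inner_add_left inner_diff_right inner_commute[of u "A v"])

lemma quadratic_form_phase:
  assumes "A \<in> selfadjoint_ops" "cmod \<theta> = 1"
  shows "A (\<theta> *\<^sub>C x) \<bullet> (\<theta> *\<^sub>C x) = A x \<bullet> x"
proof -
  have "\<theta> * cnj \<theta> = 1"
    using assms(2) complex_norm_square[of \<theta>] by simp
  then have "\<theta> * (cnj \<theta> * cinner (A x) x) = cinner (A x) x"
    by (metis mult.assoc mult_1)
  then have "cinner (A (\<theta> *\<^sub>C x)) (\<theta> *\<^sub>C x) = cinner (A x) x"
    by (simp only: selfadjoint_scaleC[OF assms(1)] cinner_bilinear mult.left_commute)
  then show ?thesis
    by (simp only: inner_eq_Re_cinner)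
qed

text \<open>Once a phase has made the inner product of \<open>u'\<close> and \<open>v\<close> real,
  \<open>u' + v\<close> and \<open>u' - v\<close> are orthogonal and their squared norms add up to
  4. By polarization the difference of the diagonal values is an off-diagonal entry times the
  product of these norms, which is at most 2.\<close>

lemma spread_le_of_offdiagonal:
  assumes A: "A \<in> selfadjoint_ops" and "r \<ge> 0"
    and off: "\<And>x y. orthonormal_pair x y \<Longrightarrow> A x \<bullet> y \<le> r"
  shows "spread_le A (2 * r)"
proof (rule spread_leI)
  fix u v :: 'a
  assume uv: "norm u = 1" "norm v = 1"
  obtain \<theta> where \<theta>: "cmod \<theta> = 1" "cinner (\<theta> *\<^sub>C u) v = complex_of_real (cmod (cinner u v))"
    by (rule exists_phase)
  define u' where "u' = \<theta> *\<^sub>C u"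
  have u': "norm u' = 1" "A u' \<bullet> u' = A u \<bullet> u"
    using uv \<theta> A by (simp_all add: u'_def quadratic_form_phase)
  have "cinner u' v = cinner v u'"
    using \<theta>(2) cinner_commute[of v u'] by (simp add: u'_def)
  then have orth: "cinner (u' + v) (u' - v) = 0"
    using u' uv by (simp add: cinner_bilinear cinner_self)
  have "A (u' + v) \<bullet> (u' - v) \<le> 2 * r"
  proof (cases "u' + v = 0 \<or> u' - v = 0")
    case True
    then show ?thesis
      using \<open>r \<ge> 0\<close> by auto
  next
    case False
    define a b where "a = norm (u' + v)" and "b = norm (u' - v)"
    have pos: "a > 0" "b > 0"
      using False by (auto simp: a_def b_def)
    have "orthonormal_pair ((1 / a) *\<^sub>R (u' + v)) ((1 / b) *\<^sub>R (u' - v))"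
      unfolding orthonormal_pair_def using orth pos by (auto simp: a_def b_def)
    from off[OF this] have "(1 / b) * ((1 / a) * (A (u' + v) \<bullet> (u' - v))) \<le> r"
      by (simp only: blinfun.scaleR_right inner_scaleR_left inner_scaleR_right)
    then have "A (u' + v) \<bullet> (u' - v) \<le> (a * b) * r"
      using pos by (simp add: field_simps)
    moreover have "2 * (a * b) \<le> a\<^sup>2 + b\<^sup>2"
      using sum_squares_bound[of a b] by simp
    moreover have "a\<^sup>2 + b\<^sup>2 = 4"
      using u' uv by (simp add: a_def b_def power2_norm_eq_inner inner_add_left inner_add_right
          inner_diff_left inner_diff_right norm_eq_1)
    ultimately show ?thesis
      using mult_right_mono[of "a * b" 2 r] \<open>r \<ge> 0\<close> by linarith
  qed
  then show "A u \<bullet> u - A v \<bullet> v \<le> 2 * r"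
    using selfadjoint_polarization[OF A, of u' v] u'(2) by simp
qed

lemma orthonormal_pair_rotate:
  assumes "orthonormal_pair x y"
  shows "orthonormal_pair ((1 / sqrt 2) *\<^sub>R (x + y)) ((1 / sqrt 2) *\<^sub>R (x - y))"
proof -
  have xy: "norm x = 1" "norm y = 1" "cinner x y = 0" "cinner y x = 0"
    using assms by (auto simp: orthonormal_pair_def cinner_eq_zero_commute[of y x])
  have "norm (x + y) = sqrt 2" "norm (x - y) = sqrt 2"
    using norm_add_orthogonal[of x y] norm_add_orthogonal[of x "-y"] xy
    by (auto intro!: real_sqrt_unique[symmetric])
  moreover have "cinner (x + y) (x - y) = 0"
    using xy by (simp add: cinner_bilinear cinner_self)
  ultimately show ?thesis
    by (simp add: orthonormal_pair_def)
qed

text \<open>Converse use of polarization: rotating an orthonormal pair by 45 degrees exhibits an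
  off-diagonal entry as half a difference of diagonal values. This yields lower bounds for the
  oscillation.\<close>

lemma offdiagonal_rotate:
  assumes "A \<in> selfadjoint_ops"
  defines "u x y \<equiv> (1 / sqrt 2) *\<^sub>R (x + y)" and "v x y \<equiv> (1 / sqrt 2) *\<^sub>R (x - y)"
  shows "A (u x y) \<bullet> u x y - A (v x y) \<bullet> v x y = 2 * (A x \<bullet> y)"
proof -
  have *: "u x y + v x y = (2 / sqrt 2) *\<^sub>R x" "u x y - v x y = (2 / sqrt 2) *\<^sub>R y"
    by (simp_all add: u_def v_def algebra_simps flip: scaleR_add_left)
  show ?thesis
    unfolding selfadjoint_polarization[OF assms(1)] * by (simp add: blinfun.scaleR_right)
qed

text \<open>Rotated orthonormal pairs are orthonormal, so the hypothesis already bounds every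
  off-diagonal entry by \<open>r / 2\<close>.\<close>

lemma spread_le_of_orthonormal:
  assumes A: "A \<in> selfadjoint_ops" and "r \<ge> 0"
    and "\<And>x y. orthonormal_pair x y \<Longrightarrow> A x \<bullet> x - A y \<bullet> y \<le> r"
  shows "spread_le A r"
proof -
  have "A x \<bullet> y \<le> r / 2" if "orthonormal_pair x y" for x y
    using assms(3)[OF orthonormal_pair_rotate[OF that]] offdiagonal_rotate[OF A, of x y] by simp
  then show ?thesis
    using spread_le_of_offdiagonal[OF A, of "r / 2"] \<open>r \<ge> 0\<close> by simp
qed

text \<open>By Pythagoras the variance is the squared length of the component of \<open>A x\<close>
  orthogonal to \<open>x\<close>.\<close>

lemma variance_at_eq_norm:
  assumes A: "A \<in> selfadjoint_ops" and "norm x = 1"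
  shows "variance_at A x = (norm (A x - (A x \<bullet> x) *\<^sub>R x))\<^sup>2"
proof -
  have "Re (cinner (A (A x)) x) = (norm (A x))\<^sup>2"
    using selfadjoint_inner[OF A, of "A x" x] by (simp add: inner_eq_Re_cinner power2_norm_eq_inner)
  then show ?thesis
    using assms(2)
    unfolding variance_at_def inner_eq_Re_cinner[symmetric]
    by (simp add: power2_norm_eq_inner inner_diff_left inner_diff_right norm_eq_1
        inner_commute[of x "A x"] power2_eq_square[of "A x \<bullet> x"])
qed

text \<open>The deviation at \<open>x\<close> is the length of the component of \<open>A x\<close>
  orthogonal to \<open>x\<close>, which is the largest off-diagonal entry that \<open>x\<close>
  forms with orthogonal unit vectors. Half the oscillation is the bound for all these entries. The
  vector \<open>e\<close> ensures that the supremum is taken over a nonempty set and that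
  \<open>r\<close> is nonnegative.\<close>

lemma max_deviation_le_iff:
  assumes A: "A \<in> selfadjoint_ops" and nontriv: "norm (e::'a::complex_hilbert_space) = 1"
  shows "max_deviation (A :: 'a \<Rightarrow>\<^sub>L 'a) \<le> r \<longleftrightarrow> spread_le A (2 * r)"
proof
  assume le: "max_deviation A \<le> r"
  have dev: "norm (A x - (A x \<bullet> x) *\<^sub>R x) \<le> r" if "norm x = 1" for x
  proof -
    have "sqrt (variance_at A x) \<le> max_deviation A"
      unfolding max_deviation_def using that by (intro cSUP_upper bdd_above_deviation) auto
    then show ?thesis
      using le that by (simp add: variance_at_eq_norm[OF A])
  qed
  have "r \<ge> 0"
    using dev[OF nontriv] norm_ge_zero order_trans by blast
  moreover have "A x \<bullet> y \<le> r" if "orthonormal_pair x y" for x y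
  proof -
    have "A x \<bullet> y = (A x - (A x \<bullet> x) *\<^sub>R x) \<bullet> y"
      using that by (simp add: orthonormal_pair_def inner_diff_left inner_eq_Re_cinner[of x y])
    also have "\<dots> \<le> r"
      using that dev[of x] norm_cauchy_schwarz[of "A x - (A x \<bullet> x) *\<^sub>R x" y]
      by (simp add: orthonormal_pair_def)
    finally show ?thesis .
  qed
  ultimately show "spread_le A (2 * r)"
    using spread_le_of_offdiagonal[OF A] by blast
next
  assume sp: "spread_le A (2 * r)"
  have "r \<ge> 0"
    using spread_leD[OF sp nontriv nontriv] by simp
  have "sqrt (variance_at A x) \<le> r" if x: "norm x = 1" for x
  proof -
    define w where "w = A x - (A x \<bullet> x) *\<^sub>R x"
    have "cinner w x = 0"
      using x by (simp add: w_def cinner_bilinear cinner_self selfadjoint_cinner_self[OF A])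
    then have orth: "cinner x w = 0"
      by (simp add: cinner_eq_zero_commute)
    have "norm w \<le> r"
    proof (cases "w = 0")
      case True
      then show ?thesis
        using \<open>r \<ge> 0\<close> by simp
    next
      case False
      \<comment> \<open>In this direction the off-diagonal entry \<open>A x \<bullet> y\<close>
        equals the full length of \<open>w\<close>.\<close>
      define y where "y = (1 / norm w) *\<^sub>R w"
      have xy: "orthonormal_pair x y"
        using x False orth by (simp add: orthonormal_pair_def y_def)
      have "A x \<bullet> y = w \<bullet> y"
        using xy by (simp add: w_def orthonormal_pair_def inner_diff_left inner_eq_Re_cinner[of x y])
      also have "\<dots> = norm w"
        using False by (simp add: y_def power2_norm_eq_inner[symmetric] power2_eq_square)
      finally have "norm w = A x \<bullet> y" ..
      moreover have "2 * (A x \<bullet> y) \<le> 2 * r"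
        using orthonormal_pair_rotate[OF xy] spread_leD[OF sp]
        by (metis offdiagonal_rotate[OF A] orthonormal_pair_def)
      ultimately show ?thesis
        by simp
    qed
    then show ?thesis
      using x by (simp add: variance_at_eq_norm[OF A] w_def)
  qed
  then show "max_deviation A \<le> r"
    unfolding max_deviation_def using nontriv by (intro cSUP_least) auto
qed

section \<open>Self-adjoint operators of rank one and two\<close>

lemma selfadjoint_closure [simp]:
  shows "A \<in> selfadjoint_ops \<Longrightarrow> B \<in> selfadjoint_ops \<Longrightarrow> A + B \<in> selfadjoint_ops"
    and "A \<in> selfadjoint_ops \<Longrightarrow> B \<in> selfadjoint_ops \<Longrightarrow> A - B \<in> selfadjoint_ops"
    and "A \<in> selfadjoint_ops \<Longrightarrow> - A \<in> selfadjoint_ops"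
    and "A \<in> selfadjoint_ops \<Longrightarrow> r *\<^sub>R A \<in> selfadjoint_ops"
    and "0 \<in> selfadjoint_ops"
  using subspace_selfadjoint_ops
  by (auto intro: subspace_add subspace_diff subspace_neg subspace_scale subspace_0)

lemma selfadjoint_id [simp]: "id_blinfun \<in> selfadjoint_ops"
  by (simp add: selfadjoint_ops_def)

text \<open>In bra-ket notation this is |y><x|.\<close>

definition rank_one :: "'a::complex_hilbert_space \<Rightarrow> 'a \<Rightarrow> 'a \<Rightarrow>\<^sub>L 'a"
  where "rank_one x y = Blinfun (\<lambda>u. cinner u x *\<^sub>C y)"

lemma rank_one_apply [simp]: "rank_one x y u = cinner u x *\<^sub>C y"
proof -
  have "bounded_linear (\<lambda>u. cinner u x *\<^sub>C y)"
  proof (rule bounded_linear_intro[where K = "norm x * norm y"])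
    show "norm (cinner u x *\<^sub>C y) \<le> norm u * (norm x * norm y)" for u
      using mult_right_mono[OF cmod_cinner_le[of u x], of "norm y"] by (simp add: mult.assoc)
  qed (simp_all add: cinner_bilinear scaleC_add_left scaleR_eq_scaleC scaleC_scaleC)
  then show ?thesis
    by (simp add: rank_one_def bounded_linear_Blinfun_apply)
qed

definition proj :: "'a::complex_hilbert_space \<Rightarrow> 'a \<Rightarrow>\<^sub>L 'a"
  where "proj x = rank_one x x"

text \<open>For a unit vector \<open>x\<close> and \<open>y\<close> orthogonal to it, these are
  exactly the self-adjoint operators whose diagonal blocks with respect to the line through
  \<open>x\<close> vanish.\<close>

definition sym_op :: "'a::complex_hilbert_space \<Rightarrow> 'a \<Rightarrow> 'a \<Rightarrow>\<^sub>L 'a"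
  where "sym_op x y = rank_one x y + rank_one y x"

lemma proj_apply [simp]: "proj x u = cinner u x *\<^sub>C x"
  by (simp add: proj_def)

lemma sym_op_apply [simp]: "sym_op x y u = cinner u x *\<^sub>C y + cinner u y *\<^sub>C x"
  by (simp add: sym_op_def blinfun.add_left)

lemma proj_selfadjoint [simp]: "proj x \<in> selfadjoint_ops"
  using cinner_commute[of x]
  by (auto simp: selfadjoint_ops_def cinner_bilinear scaleC_scaleC mult.commute)

lemma sym_op_selfadjoint [simp]: "sym_op x y \<in> selfadjoint_ops"
  using cinner_commute[of x] cinner_commute[of y]
  by (auto simp: selfadjoint_ops_def cinner_bilinear scaleC_scaleC mult.commute scaleC_add_right)

lemma proj_quadratic_form: "(cinner u x *\<^sub>C x) \<bullet> u = (cmod (cinner u x))\<^sup>2"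
  using cinner_commute[of x u]
  by (simp add: inner_eq_Re_cinner cinner_bilinear cmod_power2) (simp add: power2_eq_square)

lemma sym_op_quadratic_form:
  "(cinner u x *\<^sub>C y + cinner u y *\<^sub>C x) \<bullet> u = 2 * Re (cinner u x * cnj (cinner u y))"
  using cinner_commute[of x u] cinner_commute[of y u]
  by (simp add: inner_eq_Re_cinner cinner_bilinear)

lemma abs_sym_op_quadratic_form_le:
  "\<bar>(cinner u x *\<^sub>C y + cinner u y *\<^sub>C x) \<bullet> u\<bar> \<le> 2 * cmod (cinner u x) * cmod (cinner u y)"
  using abs_Re_le_cmod[of "cinner u x * cnj (cinner u y)"]
  by (simp only: sym_op_quadratic_form norm_mult complex_mod_cnj abs_mult abs_numeral)

section \<open>Equality modulo real multiples of the identity\<close>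

definition scalar_equiv :: "('a::complex_hilbert_space \<Rightarrow>\<^sub>L 'a) \<Rightarrow> ('a \<Rightarrow>\<^sub>L 'a) \<Rightarrow> bool"
    (infix "\<doteq>" 50)
  where "A \<doteq> B \<longleftrightarrow> (\<exists>c::real. A = B + c *\<^sub>R id_blinfun)"

lemma scalar_equivI: "A = B + c *\<^sub>R id_blinfun \<Longrightarrow> A \<doteq> B"
  by (auto simp: scalar_equiv_def)

lemma scalar_equiv_refl [simp]: "A \<doteq> A"
  by (rule scalar_equivI[of _ _ 0]) simp

lemma scalar_equiv_sym: "A \<doteq> B \<Longrightarrow> B \<doteq> A"
  unfolding scalar_equiv_def
proof (elim exE)
  fix c
  assume "A = B + c *\<^sub>R id_blinfun"
  then show "\<exists>c. B = A + c *\<^sub>R id_blinfun"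
    by (intro exI[of _ "- c"]) simp
qed

lemma scalar_equiv_trans [trans]: "A \<doteq> B \<Longrightarrow> B \<doteq> C \<Longrightarrow> A \<doteq> C"
  unfolding scalar_equiv_def by (metis add.assoc scaleR_add_left)

lemma scalar_equiv_add: "A \<doteq> B \<Longrightarrow> C \<doteq> D \<Longrightarrow> A + C \<doteq> B + D"
  unfolding scalar_equiv_def
proof (elim exE)
  fix a b
  assume "A = B + a *\<^sub>R id_blinfun" "C = D + b *\<^sub>R id_blinfun"
  then show "\<exists>c. A + C = B + D + c *\<^sub>R id_blinfun"
    by (intro exI[of _ "a + b"]) (simp add: scaleR_add_left)
qed

lemma scalar_equiv_scaleR: "A \<doteq> B \<Longrightarrow> r *\<^sub>R A \<doteq> r *\<^sub>R B"
  unfolding scalar_equiv_def by (metis scaleR_add_right scaleR_scaleR)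

lemma scalar_equiv_minus: "A \<doteq> B \<Longrightarrow> - A \<doteq> - B"
  using scalar_equiv_scaleR[of A B "-1"] by simp

lemma scalar_equiv_diff: "A \<doteq> B \<Longrightarrow> C \<doteq> D \<Longrightarrow> A - C \<doteq> B - D"
  using scalar_equiv_add[OF _ scalar_equiv_minus, of A B C D] by simp

lemma scalar_equiv_selfadjoint: "A \<doteq> B \<Longrightarrow> B \<in> selfadjoint_ops \<Longrightarrow> A \<in> selfadjoint_ops"
  by (auto simp: scalar_equiv_def)

lemma spread_le_cong: "A \<doteq> B \<Longrightarrow> spread_le A r = spread_le B r"
  by (auto simp: scalar_equiv_def spread_le_def blinfun.add_left blinfun.scaleR_left
      inner_add_left norm_eq_1)

lemma spread_le_minus: "spread_le (- A) r = spread_le A r"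
  by (auto simp: spread_le_def blinfun.minus_left)

lemma quadratic_form_ge:
  fixes A :: "'a::complex_hilbert_space \<Rightarrow>\<^sub>L 'a"
  assumes "\<And>u. norm u = 1 \<Longrightarrow> a \<le> A u \<bullet> u"
  shows "a * (norm u)\<^sup>2 \<le> A u \<bullet> u"
proof (cases "u = 0")
  case False
  have "a \<le> (1 / norm u) * ((1 / norm u) * (A u \<bullet> u))"
    using assms[of "(1 / norm u) *\<^sub>R u"] False
    by (simp only: blinfun.scaleR_right inner_scaleR_left inner_scaleR_right) simp
  then show ?thesis
    using False by (simp add: field_simps power2_eq_square)
qed simp

lemma quadratic_form_le:
  fixes A :: "'a::complex_hilbert_space \<Rightarrow>\<^sub>L 'a"
  assumes "\<And>u. norm u = 1 \<Longrightarrow> A u \<bullet> u \<le> a"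
  shows "A u \<bullet> u \<le> a * (norm u)\<^sup>2"
  using quadratic_form_ge[of "-a" "-A" u] assms by (simp add: blinfun.minus_left)

text \<open>Definiteness of the oscillation on the quotient by the scalars: the form is constant on
  the unit sphere, and after subtraction of the constant it vanishes everywhere, so real
  polarization makes the operator vanish.\<close>

lemma spread_le_zero_imp_scalar:
  assumes A: "A \<in> selfadjoint_ops" and sp: "spread_le A 0"
  shows "A \<doteq> 0"
proof (cases "\<exists>e::'a. norm e = 1")
  case False
  have "x = 0" for x :: 'a
    using False by (metis norm_sgn)
  then have "A = 0"
    by (intro blinfun_eqI) metis
  then show ?thesis
    by simp
next
  case True
  then obtain e :: 'a where e: "norm e = 1"
    by blast
  define c where "c = A e \<bullet> e"
  define B where "B = A - c *\<^sub>R id_blinfun"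
  have B: "B \<in> selfadjoint_ops"
    using A by (simp add: B_def)
  have "B u \<bullet> u = 0" if "norm u = 1" for u
  proof -
    have "A u \<bullet> u = c"
      using spread_leD[OF sp that e] spread_leD[OF sp e that] by (simp add: c_def)
    then show ?thesis
      using that by (simp add: B_def blinfun.diff_left blinfun.scaleR_left inner_diff_left norm_eq_1)
  qed
  then have q: "B u \<bullet> u = 0" for u
    using quadratic_form_ge[of 0 B u] quadratic_form_le[of B 0 u] by force
  have "B x \<bullet> y = 0" for x y
    using q[of "x + y"] q[of x] q[of y] selfadjoint_inner[OF B, of x y]
    by (simp add: blinfun.add_right inner_add_left inner_add_right inner_commute)
  then have "B = 0"
    by (intro blinfun_eqI) (metis inner_eq_zero_iff blinfun.zero_left)
  then show ?thesis
    by (intro scalar_equivI[of _ _ c]) (simp add: B_def)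
qed

text \<open>This says that the square of \<open>A\<close> is at most \<open>A\<close> if
  \<open>A\<close> lies between 0 and the identity. No square root is required: the form is
  nonnegative at \<open>u - A u\<close>, and its value at \<open>A u\<close> is at most the squared
  norm of \<open>A u\<close>.\<close>

lemma norm_image_le_quadratic_form:
  assumes A: "A \<in> selfadjoint_ops" and "\<And>u. 0 \<le> A u \<bullet> u" "\<And>u. A u \<bullet> u \<le> (norm u)\<^sup>2"
  shows "(norm (A u))\<^sup>2 \<le> A u \<bullet> u"
proof -
  have "A (u - A u) \<bullet> (u - A u) = A u \<bullet> u - 2 * (norm (A u))\<^sup>2 + A (A u) \<bullet> A u"
    using selfadjoint_inner[OF A, of "A u" u]
    by (simp add: blinfun.diff_right inner_diff_left inner_diff_right power2_norm_eq_inner)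
  then show ?thesis
    using assms(2)[of "u - A u"] assms(3)[of "A u"] by linarith
qed

subsection \<open>Projections as extreme points\<close>

definition projector :: "('a::complex_hilbert_space \<Rightarrow>\<^sub>L 'a) \<Rightarrow> bool"
  where "projector R \<longleftrightarrow> R \<in> selfadjoint_ops \<and> (\<forall>x. R (R x) = R x)"

lemma projector_quadratic_form: "projector R \<Longrightarrow> R u \<bullet> u = (norm (R u))\<^sup>2"
  using selfadjoint_inner[of R "R u" u] by (simp add: projector_def power2_norm_eq_inner)

lemma projector_pythagoras:
  assumes "projector R"
  shows "(norm u)\<^sup>2 = (norm (R u))\<^sup>2 + (norm (u - R u))\<^sup>2"
  using projector_quadratic_form[OF assms, of u]
  by (simp add: power2_norm_eq_inner inner_diff_left inner_diff_right inner_commute)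

lemma projector_complement: "projector R \<Longrightarrow> projector (id_blinfun - R)"
  by (auto simp: projector_def blinfun.diff_left blinfun.diff_right)

lemma projector_proj: "norm e = 1 \<Longrightarrow> projector (proj e)"
  by (simp add: projector_def cinner_bilinear cinner_self)

lemma projector_spread:
  assumes "projector R"
  shows "spread_le R 1"
proof -
  have "(norm (R u))\<^sup>2 \<le> (norm u)\<^sup>2" for u
    using projector_pythagoras[OF assms, of u] zero_le_power2[of "norm (u - R u)"] by linarith
  then have "R u \<bullet> u \<le> 1" if "norm u = 1" for u
    using that unfolding projector_quadratic_form[OF assms] by (metis one_power2)
  then have "spread_le R (1 - 0)"
    by (intro spread_le_bounds) (simp_all add: projector_quadratic_form[OF assms])
  then show ?thesis
    by simp
qed

text \<open>Between a unit vector in the range of \<open>R\<close> and one in the kernel the forms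
  of \<open>B\<close> and \<open>C\<close> differ by at most 1 each and by 2 together, hence by
  exactly 1 each. Shifted by a scalar, \<open>B\<close> becomes an operator \<open>D\<close> between
  0 and the identity whose form is 0 on unit vectors of the kernel and 1 on those of the range. Such
  extremal values are attained only at eigenvectors, so \<open>D\<close> agrees with
  \<open>R\<close>. The vectors \<open>x0\<close> and \<open>y0\<close> witness that range and
  kernel are nontrivial.\<close>

lemma projector_extreme:
  assumes R: "projector R" and x0: "norm x0 = 1" "R x0 = x0" and y0: "norm y0 = 1" "R y0 = 0"
    and B: "B \<in> selfadjoint_ops" and sum: "B + C = 2 *\<^sub>R R"
    and spB: "spread_le B 1" and spC: "spread_le C 1"
  shows "B \<doteq> R"
proof -
  have Capp: "C u = 2 *\<^sub>R R u - B u" for u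
  proof -
    have "C = 2 *\<^sub>R R - B"
      using sum by (simp add: eq_diff_eq add.commute)
    then show ?thesis
      by (simp add: blinfun.diff_left blinfun.scaleR_left)
  qed
  have gap: "B x \<bullet> x - B y \<bullet> y = 1"
    if "norm x = 1" "R x = x" "norm y = 1" "R y = 0" for x y
    using spread_leD[OF spB, of x y] spread_leD[OF spC, of x y] that
    by (simp add: Capp inner_diff_left norm_eq_1)
  define b where "b = B y0 \<bullet> y0"
  define D where "D = B - b *\<^sub>R id_blinfun"
  have D: "D \<in> selfadjoint_ops"
    using B by (simp add: D_def)
  have Dq: "D u \<bullet> u = B u \<bullet> u - b * (norm u)\<^sup>2" for u
    by (simp add: D_def blinfun.diff_left blinfun.scaleR_left inner_diff_left power2_norm_eq_inner)
  \<comment> \<open>The form of \<open>B\<close> takes the value \<open>b + 1\<close> at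
    \<open>x0\<close>, so an oscillation of at most 1 keeps it above \<open>b\<close>. The upper
    bound comes from \<open>y0\<close> in the same way.\<close>
  have "0 \<le> D u \<bullet> u" if "norm u = 1" for u
    using spread_leD[OF spB x0(1) that] gap[OF x0 y0] that by (simp add: Dq b_def)
  then have ge: "0 \<le> D u \<bullet> u" for u
    using quadratic_form_ge[of 0 D u] by simp
  have "D u \<bullet> u \<le> 1" if "norm u = 1" for u
    using spread_leD[OF spB that y0(1)] that by (simp add: Dq b_def)
  then have le: "D u \<bullet> u \<le> (norm u)\<^sup>2" for u
    using quadratic_form_le[of D 1 u] by simp
  have ker1: "D y = 0" if "norm y = 1" "R y = 0" for y
  proof -
    have "D y \<bullet> y = 0"
      using gap[OF x0 that] gap[OF x0 y0] that by (simp add: Dq b_def)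
    then show ?thesis
      using norm_image_le_quadratic_form[OF D ge le, of y] by simp
  qed
  have ran1: "D x = x" if "norm x = 1" "R x = x" for x
  proof -
    have "D x \<bullet> x = 1"
      using gap[OF that y0] that by (simp add: Dq b_def)
    \<comment> \<open>The argument used on the kernel is repeated for the identity minus
      \<open>D\<close>, whose form vanishes at \<open>x\<close>.\<close>
    moreover have "(norm ((id_blinfun - D) x))\<^sup>2 \<le> (id_blinfun - D) x \<bullet> x"
      using D ge le by (intro norm_image_le_quadratic_form)
        (simp_all add: blinfun.diff_left inner_diff_left power2_norm_eq_inner)
    ultimately show ?thesis
      using that by (simp add: blinfun.diff_left inner_diff_left norm_eq_1)
  qed
  have ker: "D y = 0" if "R y = 0" for y
  proof (cases "y = 0")
    case False
    have "D ((1 / norm y) *\<^sub>R y) = 0"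
      using False that by (intro ker1) (simp_all add: blinfun.scaleR_right)
    then show ?thesis
      using False by (simp add: blinfun.scaleR_right)
  qed simp
  have ran: "D x = x" if "R x = x" for x
  proof (cases "x = 0")
    case False
    have "D ((1 / norm x) *\<^sub>R x) = (1 / norm x) *\<^sub>R x"
      using False that by (intro ran1) (simp_all add: blinfun.scaleR_right)
    then show ?thesis
      using False by (simp add: blinfun.scaleR_right)
  qed simp
  have "D u = R u" for u
    using ran[of "R u"] ker[of "u - R u"] R by (simp add: projector_def blinfun.diff_right)
  then have "D = R"
    by (rule blinfun_eqI)
  then show ?thesis
    by (intro scalar_equivI[of _ _ b]) (simp add: D_def algebra_simps)
qed

text \<open>If \<open>0 \<le> A \<le> I\<close>, then \<open>A\<close> is the midpoint of \<open>A\<^sup>2\<close> and \<open>2 A - A\<^sup>2\<close>, which both lie between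
  \<open>0\<close> and \<open>I\<close>; so extremality forces \<open>A\<^sup>2 = A\<close>.\<close>

lemma extreme_imp_projector:
  assumes A: "A \<in> selfadjoint_ops" and sp: "spread_le A 1" and nsp: "\<not> spread_le A 0"
    and ext: "\<And>B C. B \<in> selfadjoint_ops \<Longrightarrow> C \<in> selfadjoint_ops \<Longrightarrow> B + C = 2 *\<^sub>R A \<Longrightarrow>
      spread_le B 1 \<Longrightarrow> spread_le C 1 \<Longrightarrow> B \<doteq> A"
  obtains R where "projector R" "A \<doteq> R"
proof -
  define S where "S = (\<lambda>u. A u \<bullet> u) ` {u. norm u = 1}"
  obtain e :: 'a where e: "norm e = 1"
    using nsp unfolding spread_le_def by blast
  \<comment> \<open>Subtracting the infimum of the form places \<open>D\<close> between 0 and the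
    identity.\<close>
  define m where "m = Inf S"
  have S: "S \<noteq> {}"
    using e by (auto simp: S_def)
  have "bdd_below S"
    unfolding S_def
  proof (rule bdd_belowI2)
    show "A e \<bullet> e - 1 \<le> A u \<bullet> u" if "u \<in> {u. norm u = 1}" for u
      using spread_leD[OF sp e, of u] that by simp
  qed
  then have m_le: "m \<le> A u \<bullet> u" if "norm u = 1" for u
    unfolding m_def using that by (intro cInf_lower) (auto simp: S_def)
  have le_m: "A u \<bullet> u - 1 \<le> m" if "norm u = 1" for u
    unfolding m_def
  proof (rule cInf_greatest[OF S])
    show "A u \<bullet> u - 1 \<le> s" if "s \<in> S" for s
      using that spread_leD[OF sp \<open>norm u = 1\<close>] by (force simp: S_def)
  qed
  define D where "D = A - m *\<^sub>R id_blinfun"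
  have D: "D \<in> selfadjoint_ops"
    using A by (simp add: D_def)
  have Dq: "D u \<bullet> u = A u \<bullet> u - m" if "norm u = 1" for u
    using that
    by (simp add: D_def blinfun.diff_left blinfun.scaleR_left inner_diff_left norm_eq_1)
  have ge: "0 \<le> D u \<bullet> u" for u
    using quadratic_form_ge[of 0 D u] m_le Dq by simp
  have le: "D u \<bullet> u \<le> (norm u)\<^sup>2" for u
    using quadratic_form_le[of D 1 u] le_m Dq by force
  note sq = norm_image_le_quadratic_form[OF D ge le]
  define D2 where "D2 = D o\<^sub>L D"
  have D2: "D2 \<in> selfadjoint_ops"
    using D by (simp add: D2_def selfadjoint_ops_def)
  have D2q: "D2 u \<bullet> u = (norm (D u))\<^sup>2" for u
    using selfadjoint_inner[OF D, of "D u" u] by (simp add: D2_def power2_norm_eq_inner)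
  have "(norm (D u))\<^sup>2 \<le> 1" if "norm u = 1" for u
    using sq[of u] le[of u] that by simp
  then have "spread_le D2 (1 - 0)"
    by (intro spread_le_bounds) (simp_all add: D2q)
  moreover have "spread_le (2 *\<^sub>R D - D2) (1 - 0)"
  proof (rule spread_le_bounds)
    fix u :: 'a
    assume u: "norm u = 1"
    show "0 \<le> (2 *\<^sub>R D - D2) u \<bullet> u"
      using sq[of u] ge[of u]
      by (simp add: blinfun.diff_left blinfun.scaleR_left inner_diff_left D2q)
    have "0 \<le> (norm (u - D u))\<^sup>2"
      by simp
    also have "\<dots> = 1 - 2 * (D u \<bullet> u) + (norm (D u))\<^sup>2"
      using u by (simp only: power2_norm_eq_inner inner_diff_left inner_diff_right norm_eq_1)
        (simp add: inner_commute)
    finally show "(2 *\<^sub>R D - D2) u \<bullet> u \<le> 1"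
      by (simp add: blinfun.diff_left blinfun.scaleR_left inner_diff_left D2q)
  qed
  \<comment> \<open>Both halves are shifted back by \<open>m\<close>, so that they add up to exactly
    \<open>2 *\<^sub>R A\<close>.\<close>
  moreover define B where "B = D2 + m *\<^sub>R id_blinfun"
  moreover define C where "C = 2 *\<^sub>R D - D2 + m *\<^sub>R id_blinfun"
  moreover have "B \<doteq> D2" "C \<doteq> 2 *\<^sub>R D - D2"
    by (auto intro: scalar_equivI simp: B_def C_def)
  ultimately have "spread_le B 1" "spread_le C 1"
    by (simp_all add: spread_le_cong)
  moreover have "B + C = 2 *\<^sub>R A"
    by (simp add: B_def C_def D_def scaleR_2)
  moreover have "B \<in> selfadjoint_ops" "C \<in> selfadjoint_ops"
    using D D2 by (simp_all add: B_def C_def)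
  ultimately have "B \<doteq> A"
    by (intro ext)
  then obtain c where c: "B = A + c *\<^sub>R id_blinfun"
    by (auto simp: scalar_equiv_def)
  have "D2 = D + c *\<^sub>R id_blinfun"
    using c by (simp add: B_def D_def algebra_simps)
  then have diff: "(norm (D u))\<^sup>2 = D u \<bullet> u + c" if "norm u = 1" for u
    using D2q[of u] that by (simp add: blinfun.add_left blinfun.scaleR_left inner_add_left norm_eq_1)
  \<comment> \<open>The inequality \<open>sq\<close> excludes positive \<open>c\<close>. A negative
    \<open>c\<close> would make the squared norm of \<open>D u\<close> negative at some
    \<open>u\<close> where the form of \<open>D\<close> is close to its infimum 0.\<close>
  have "c = 0"
  proof (rule ccontr)
    assume "c \<noteq> 0"
    then obtain s where "s \<in> S" "s < m + \<bar>c\<bar>"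
      using cInf_lessD[OF S, of "m + \<bar>c\<bar>"] by (auto simp: m_def)
    then obtain u where u: "norm u = 1" "A u \<bullet> u < m + \<bar>c\<bar>"
      by (auto simp: S_def)
    then have "D u \<bullet> u < \<bar>c\<bar>"
      using Dq by simp
    then show False
      using diff[OF u(1)] sq[of u] zero_le_power2[of "norm (D u)"] by linarith
  qed
  then have "D2 = D"
    using \<open>D2 = D + c *\<^sub>R id_blinfun\<close> by simp
  then have "D (D u) = D u" for u
    unfolding D2_def by (metis blinfun_apply_blinfun_compose)
  then have "projector D"
    using D by (simp add: projector_def)
  moreover have "A \<doteq> D"
    by (rule scalar_equivI[of _ _ m]) (simp add: D_def)
  ultimately show ?thesis
    using that by blast
qed

subsection \<open>Off-diagonal operators\<close>

text \<open>For projections \<open>P\<close> this says that the diagonal blocks of \<open>B\<close> are the same multiple of the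
  identity, but it is phrased such that maps preserving \<open>spread_le\<close> respect it.\<close>

definition offdiagonal :: "('a::complex_hilbert_space \<Rightarrow>\<^sub>L 'a) \<Rightarrow> ('a \<Rightarrow>\<^sub>L 'a) \<Rightarrow> bool"
  where "offdiagonal P B \<longleftrightarrow>
    (\<exists>C. \<forall>t>0. spread_le (t *\<^sub>R P + B) (t + C / t) \<and> spread_le (t *\<^sub>R P - B) (t + C / t))"

lemma offdiagonal_cong: "P \<doteq> P' \<Longrightarrow> B \<doteq> B' \<Longrightarrow> offdiagonal P B \<longleftrightarrow> offdiagonal P' B'"
  unfolding offdiagonal_def
  by (simp add: spread_le_cong[OF scalar_equiv_add[OF scalar_equiv_scaleR]]
      spread_le_cong[OF scalar_equiv_diff[OF scalar_equiv_scaleR]])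

text \<open>The form of \<open>sym_op x y\<close> at \<open>u\<close> is at most 2 s a b, where a
  and b are the lengths of the components of \<open>u\<close> in the range and the kernel of
  \<open>R\<close>. Weighing a and b by powers of \<open>t\<close> keeps the forms of
  \<open>t *\<^sub>R R\<close> plus or minus this operator between -s^2/t and t + s^2/t.\<close>

lemma offdiagonal_sym_op:
  assumes R: "projector R" and x: "R x = x" and y: "R y = 0"
  shows "offdiagonal R (sym_op x y)"
proof -
  define s where "s = norm x * norm y"
  have sa: "R \<in> selfadjoint_ops"
    using R by (simp add: projector_def)
  have q: "\<bar>sym_op x y u \<bullet> u\<bar> \<le> 2 * s * (norm (R u) * norm (u - R u))" for u
  proof -
    have "cinner u x = cinner (R u) x" "cinner u y = cinner (u - R u) y"
      using selfadjoint_cinner[OF sa, of u x] selfadjoint_cinner[OF sa, of u y] x y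
      by (simp_all add: cinner_diff_left)
    then have "cmod (cinner u x) * cmod (cinner u y)
        \<le> (norm (R u) * norm x) * (norm (u - R u) * norm y)"
      by (simp add: mult_mono cmod_cinner_le)
    then show ?thesis
      using abs_sym_op_quadratic_form_le[of u x y] by (simp add: s_def algebra_simps)
  qed
  have bounds: "- (s\<^sup>2 / t) \<le> t * (R u \<bullet> u) + r \<and> t * (R u \<bullet> u) + r \<le> t + s\<^sup>2 / t"
    if u: "norm u = 1" and t: "t > 0" and r: "\<bar>r\<bar> \<le> \<bar>sym_op x y u \<bullet> u\<bar>" for u t r
  proof -
    define a b where "a = norm (R u)" and "b = norm (u - R u)"
    have ab: "a\<^sup>2 + b\<^sup>2 = 1" "a \<ge> 0" "b \<ge> 0" "R u \<bullet> u = a\<^sup>2"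
      using projector_pythagoras[OF R, of u] projector_quadratic_form[OF R, of u] u
      by (simp_all add: a_def b_def)
    have rb: "\<bar>r\<bar> \<le> 2 * s * (a * b)"
      using q[of u] r by (simp add: a_def b_def)
    \<comment> \<open>The first square gives the lower bound, the second one the upper
      bound.\<close>
    have "0 \<le> (t * a - s * b)\<^sup>2 / t" "0 \<le> (t * b - s * a)\<^sup>2 / t"
      using t by simp_all
    then have "2 * s * (a * b) \<le> t * a\<^sup>2 + s\<^sup>2 / t * b\<^sup>2" "2 * s * (a * b) \<le> t * b\<^sup>2 + s\<^sup>2 / t * a\<^sup>2"
      using t by (simp_all add: power2_diff power_mult_distrib field_simps power2_eq_square)
    moreover have "s\<^sup>2 / t * b\<^sup>2 \<le> s\<^sup>2 / t" "s\<^sup>2 / t * a\<^sup>2 \<le> s\<^sup>2 / t"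
      using ab t by (intro mult_left_le; simp; smt (verit) zero_le_power2)+
    moreover have "t * a\<^sup>2 + t * b\<^sup>2 = t"
      using ab by (metis distrib_left mult.right_neutral)
    ultimately show ?thesis
      using rb ab(4) by (simp only:) linarith
  qed
  have "spread_le (t *\<^sub>R R + sym_op x y) (t + s\<^sup>2 / t - - (s\<^sup>2 / t)) \<and>
      spread_le (t *\<^sub>R R - sym_op x y) (t + s\<^sup>2 / t - - (s\<^sup>2 / t))" if "t > 0" for t
  proof (intro conjI spread_le_bounds)
    fix u :: 'a
    assume u: "norm u = 1"
    show "- (s\<^sup>2 / t) \<le> (t *\<^sub>R R + sym_op x y) u \<bullet> u" "(t *\<^sub>R R + sym_op x y) u \<bullet> u \<le> t + s\<^sup>2 / t"
      using bounds[OF u that, of "sym_op x y u \<bullet> u"]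
      by (simp_all add: blinfun.add_left blinfun.scaleR_left inner_add_left del: sym_op_apply)
    show "- (s\<^sup>2 / t) \<le> (t *\<^sub>R R - sym_op x y) u \<bullet> u" "(t *\<^sub>R R - sym_op x y) u \<bullet> u \<le> t + s\<^sup>2 / t"
      using bounds[OF u that, of "- (sym_op x y u \<bullet> u)"]
      by (simp_all add: blinfun.diff_left blinfun.scaleR_left inner_diff_left del: sym_op_apply)
  qed
  then show ?thesis
    unfolding offdiagonal_def by (intro exI[of _ "2 * s\<^sup>2"]) (simp add: algebra_simps)
qed

lemma le_zero_if_le_inverse:
  fixes a C :: real
  assumes "\<And>t. t > 0 \<Longrightarrow> a \<le> C / t"
  shows "a \<le> 0"
proof (rule ccontr)
  assume "\<not> a \<le> 0"
  then have "a > 0" by simp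
  \<comment> \<open>An explicit \<open>t\<close> large enough to push \<open>C / t\<close> below
    \<open>a\<close>.\<close>
  then have "a \<le> C / ((\<bar>C\<bar> + 1) / a)"
    by (intro assms) (simp add: add_nonneg_pos)
  also have "\<dots> = a * (C / (\<bar>C\<bar> + 1))"
    by simp
  also have "\<dots> < a * 1"
    using \<open>a > 0\<close> by (intro mult_strict_left_mono) (auto simp: divide_less_eq)
  finally show False by simp
qed

text \<open>When the two oscillation bounds are tested at \<open>e\<close> and at a unit vector
  \<open>y\<close> orthogonal to \<open>e\<close>, the terms linear in \<open>t\<close> cancel. As
  \<open>t\<close> grows, the forms of \<open>B\<close> at \<open>e\<close> and \<open>y\<close> are
  seen to agree. After subtraction of this common value the diagonal blocks vanish, and
  \<open>w\<close> is the image of \<open>e\<close>.\<close>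

lemma offdiagonal_proj_cases:
  assumes e: "norm e = 1" and B: "B \<in> selfadjoint_ops" and off: "offdiagonal (proj e) B"
  obtains w where "cinner w e = 0" "B \<doteq> sym_op e w"
proof -
  obtain C where C: "\<And>t. t > 0 \<Longrightarrow> spread_le (t *\<^sub>R proj e + B) (t + C / t)"
    "\<And>t. t > 0 \<Longrightarrow> spread_le (t *\<^sub>R proj e - B) (t + C / t)"
    using off by (auto simp: offdiagonal_def)
  define c where "c = B e \<bullet> e"
  define D where "D = B - c *\<^sub>R id_blinfun"
  have D: "D \<in> selfadjoint_ops"
    using B by (simp add: D_def)
  have ee: "cinner e e = 1"
    using e by (simp add: cinner_self)
  have "B y \<bullet> y = c" if y: "norm y = 1" "cinner y e = 0" for y
  proof -
    have "c - B y \<bullet> y \<le> C / t \<and> B y \<bullet> y - c \<le> C / t" if "t > 0" for t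
      using spread_leD[OF C(1)[OF that] e y(1)] spread_leD[OF C(2)[OF that] e y(1)] y(2) e ee
      by (simp add: blinfun.add_left blinfun.diff_left blinfun.scaleR_left inner_add_left
          inner_diff_left c_def scaleC_one norm_eq_1)
    then show ?thesis
      using le_zero_if_le_inverse[of "c - B y \<bullet> y" C] le_zero_if_le_inverse[of "B y \<bullet> y - c" C]
      by force
  qed
  then have "D y \<bullet> y = 0" if "norm y = 1" "cinner y e = 0" for y
    using that by (simp add: D_def blinfun.diff_left blinfun.scaleR_left inner_diff_left norm_eq_1)
  then have q0: "D y \<bullet> y = 0" if "cinner y e = 0" for y
  proof (cases "y = 0")
    case False
    have "(1 / norm y) * ((1 / norm y) * (D y \<bullet> y)) = 0"
      using \<open>\<And>y. \<lbrakk>norm y = 1; cinner y e = 0\<rbrakk> \<Longrightarrow> D y \<bullet> y = 0\<close>[of "(1 / norm y) *\<^sub>R y"] that False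
      by (simp only: blinfun.scaleR_right inner_scaleR_left inner_scaleR_right) simp
    then show ?thesis
      using False by simp
  qed simp
  have q1: "D y \<bullet> y' = 0" if "cinner y e = 0" "cinner y' e = 0" for y y'
    using q0[of "y + y'"] q0[of y] q0[of y'] that selfadjoint_inner[OF D, of y y']
    by (simp add: cinner_add_left blinfun.add_right inner_add_left inner_add_right inner_commute)
  define w where "w = D e"
  have "D e \<bullet> e = 0"
    using e by (simp add: D_def c_def blinfun.diff_left blinfun.scaleR_left inner_diff_left norm_eq_1)
  then have we: "cinner w e = 0"
    using selfadjoint_cinner_self[OF D, of e] by (simp add: w_def)
  have "D u = sym_op e w u" for u
  proof -
    define y where "y = u - cinner u e *\<^sub>C e"
    have y: "cinner y e = 0"
      using norm_diff_component(1)[OF e] by (simp add: y_def)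
    \<comment> \<open>The part of \<open>D y\<close> in the complement of \<open>e\<close>. Its
      squared norm is \<open>D y \<bullet> g\<close>, which \<open>q1\<close> shows to be 0.\<close>
    define g where "g = D y - cinner (D y) e *\<^sub>C e"
    have g: "cinner g e = 0"
      using norm_diff_component(1)[OF e] by (simp add: g_def)
    have "D y \<bullet> g = g \<bullet> g + (cinner (D y) e *\<^sub>C e) \<bullet> g"
      by (simp add: g_def flip: inner_add_left)
    also have "(cinner (D y) e *\<^sub>C e) \<bullet> g = 0"
      using g cinner_eq_zero_commute[of g e] by (simp add: inner_eq_Re_cinner cinner_bilinear)
    finally have "g = 0"
      using q1[OF y g] by simp
    then have "D y = cinner y w *\<^sub>C e"
      using selfadjoint_cinner[OF D, of y e] by (simp add: g_def w_def)
    also have "cinner y w = cinner u w"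
      using we cinner_eq_zero_commute[of w e] by (simp add: y_def cinner_bilinear)
    finally have "D u = D (cinner u e *\<^sub>C e) + cinner u w *\<^sub>C e"
      by (simp add: y_def blinfun.diff_right diff_eq_eq add.commute)
    then show ?thesis
      by (simp add: selfadjoint_scaleC[OF D] w_def)
  qed
  then have "D = sym_op e w"
    by (rule blinfun_eqI)
  then have "B \<doteq> sym_op e w"
    by (intro scalar_equivI[of _ _ c]) (simp add: D_def algebra_simps)
  then show ?thesis
    using we that by blast
qed

lemma proj_offdiagonal_sym_op:
  "norm e = 1 \<Longrightarrow> cinner w e = 0 \<Longrightarrow> offdiagonal (proj e) (sym_op e w)"
  by (intro offdiagonal_sym_op) (simp_all add: projector_proj cinner_self scaleC_one)

lemma sym_op_add_right: "sym_op x (y + z) = sym_op x y + sym_op x z"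
  by (intro blinfun_eqI) (simp add: blinfun.add_left scaleC_add_right scaleC_add_left cinner_add_right)

lemma sym_op_scaleR_right: "sym_op x (r *\<^sub>R y) = r *\<^sub>R sym_op x y"
  by (intro blinfun_eqI)
    (simp add: blinfun.scaleR_left scaleR_add_right scaleC_scaleR
      flip: scaleC_scaleC scaleR_eq_scaleC)

lemma sym_op_diff_right: "sym_op x (y - z) = sym_op x y - sym_op x z"
  using sym_op_add_right[of x "y - z" z] by simp

text \<open>At \<open>e\<close> the two operators differ by a multiple of \<open>e\<close>, while
  \<open>w\<close> and \<open>w'\<close> have no component along \<open>e\<close>. So an
  off-diagonal operator modulo scalars determines its vector.\<close>

lemma sym_op_equiv_cancel:
  assumes e: "norm e = 1" and "cinner w e = 0" "cinner w' e = 0" and eq: "sym_op e w \<doteq> sym_op e w'"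
  shows "w = w'"
proof -
  obtain c where c: "sym_op e w = sym_op e w' + c *\<^sub>R id_blinfun"
    using eq by (auto simp: scalar_equiv_def)
  have "cinner e w = 0" "cinner e w' = 0"
    using assms by (simp_all add: cinner_eq_zero_commute[of e])
  then have w: "w = w' + c *\<^sub>R e"
    using arg_cong[OF c, of "\<lambda>T. T e"] e
    by (simp add: cinner_self scaleC_one blinfun.add_left blinfun.scaleR_left)
  then have "c = 0"
    using arg_cong[OF w, of "\<lambda>x. cinner x e"] assms by (simp add: cinner_add_left cinner_self)
  then show ?thesis
    using w by simp
qed

text \<open>On the plane spanned by \<open>e\<close> and a nonzero \<open>z\<close> the eigenvalues
  are plus and minus \<open>norm z\<close>. Modulo scalars, half the oscillation therefore turns the
  operators off-diagonal to \<open>proj e\<close> into a copy of the orthogonal complement of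
  \<open>e\<close> with its Hilbert norm.\<close>

lemma sym_op_spread_iff:
  assumes e: "norm e = 1" and z: "cinner z e = 0"
  shows "spread_le (sym_op e z) r \<longleftrightarrow> 2 * norm z \<le> r"
proof
  assume sp: "spread_le (sym_op e z) r"
  show "2 * norm z \<le> r"
  proof (cases "z = 0")
    case True
    then show ?thesis
      using spread_leD[OF sp e e] by simp
  next
    case False
    define y where "y = (1 / norm z) *\<^sub>R z"
    have ey: "orthonormal_pair e y"
      using e z False by (simp add: orthonormal_pair_def y_def cinner_eq_zero_commute[of e])
    have "2 * (sym_op e z e \<bullet> y) \<le> r"
      using spread_leD[OF sp] orthonormal_pair_rotate[OF ey]
      by (metis offdiagonal_rotate[OF sym_op_selfadjoint] orthonormal_pair_def)
    moreover have "sym_op e z e \<bullet> y = norm z"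
      using e z False cinner_eq_zero_commute[of z e]
      by (simp add: y_def cinner_self scaleC_one power2_norm_eq_inner[symmetric] power2_eq_square)
    ultimately show ?thesis
      by simp
  qed
next
  assume le: "2 * norm z \<le> r"
  have "\<bar>sym_op e z u \<bullet> u\<bar> \<le> norm z" if u: "norm u = 1" for u
  proof -
    define y where "y = u - cinner u e *\<^sub>C e"
    define a where "a = cmod (cinner u e)"
    have "cinner u z = cinner y z"
      using cinner_eq_zero_commute[of z e] z by (simp add: y_def cinner_bilinear)
    then have "cmod (cinner u e) * cmod (cinner u z) \<le> a * (norm y * norm z)"
      by (simp add: a_def mult_left_mono cmod_cinner_le)
    then have "\<bar>sym_op e z u \<bullet> u\<bar> \<le> (2 * a * norm y) * norm z"
      using abs_sym_op_quadratic_form_le[of u e z] by simp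
    also have "2 * a * norm y \<le> a\<^sup>2 + (norm y)\<^sup>2"
      by (rule sum_squares_bound)
    also have "a\<^sup>2 + (norm y)\<^sup>2 = 1"
      using norm_diff_component(2)[OF e, of u] u by (simp add: a_def y_def)
    finally show ?thesis
      by (simp add: mult_right_mono)
  qed
  then have "- norm z \<le> sym_op e z u \<bullet> u \<and> sym_op e z u \<bullet> u \<le> norm z" if "norm u = 1" for u
    using that by (simp only: abs_le_iff minus_le_iff)
  then have "spread_le (sym_op e z) (norm z - - norm z)"
    by (intro spread_le_bounds) blast+
  then show "spread_le (sym_op e z) r"
    using le by (simp add: spread_le_def del: sym_op_apply) (meson order_trans)
qed

lemma exists_unit_component:
  fixes v w :: "'a::complex_inner_space"
  assumes w: "norm w = 1" and v: "v \<noteq> cinner v w *\<^sub>C w"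
  obtains r where "orthonormal_pair w (r *\<^sub>R (v - cinner v w *\<^sub>C w))"
proof -
  define y where "y = v - cinner v w *\<^sub>C w"
  have "y \<noteq> 0" "cinner w y = 0"
    using v norm_diff_component(1)[OF w, of v] by (simp_all add: y_def cinner_eq_zero_commute[of w])
  then have "orthonormal_pair w ((1 / norm y) *\<^sub>R y)"
    using w by (simp add: orthonormal_pair_def)
  then show ?thesis
    using that by (simp add: y_def)
qed

text \<open>A vector of the range that is not a multiple of \<open>w\<close> would, after removal of
  its component along \<open>w\<close>, complete \<open>w\<close> to an orthonormal pair in the
  range.\<close>

lemma projector_eq_proj:
  assumes R: "projector R" and "R \<noteq> 0"
    and no_pair: "\<And>x y. orthonormal_pair x y \<Longrightarrow> R x = x \<Longrightarrow> R y \<noteq> y"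
  obtains w where "norm w = 1" "R = proj w"
proof -
  have sa: "R \<in> selfadjoint_ops" and idem: "R (R x) = R x" for x
    using R by (simp_all add: projector_def)
  obtain x where x: "R x \<noteq> 0"
    using \<open>R \<noteq> 0\<close> by (metis blinfun_eqI zero_blinfun.rep_eq)
  define w where "w = (1 / norm (R x)) *\<^sub>R R x"
  have w: "norm w = 1" "R w = w"
    using x by (simp_all add: w_def blinfun.scaleR_right idem)
  have "R u = proj w u" for u
  proof -
    have "R u = cinner (R u) w *\<^sub>C w"
    proof (rule ccontr)
      assume "R u \<noteq> cinner (R u) w *\<^sub>C w"
      then obtain r where r: "orthonormal_pair w (r *\<^sub>R (R u - cinner (R u) w *\<^sub>C w))"
        by (rule exists_unit_component[OF w(1)])
      show False
        using no_pair[OF r w(2)] w(2)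
        by (simp add: blinfun.scaleR_right blinfun.diff_right selfadjoint_scaleC[OF sa] idem)
    qed
    also have "cinner (R u) w = cinner u w"
      using w(2) by (simp add: selfadjoint_cinner[OF sa])
    finally show ?thesis
      by simp
  qed
  then have "R = proj w"
    by (rule blinfun_eqI)
  then show ?thesis
    using w(1) that by blast
qed

text \<open>Each form is bounded by the two squared coefficients it involves, and by Bessel all four
  add up to at most 1. Each summand alone already has oscillation 2, so on these two operators the
  oscillation behaves like a maximum norm and violates the parallelogram law.\<close>

lemma two_sym_ops_spread:
  assumes x: "orthonormal_pair x1 x2" and y: "orthonormal_pair y1 y2"
    and xy: "cinner x1 y1 = 0" "cinner x1 y2 = 0" "cinner x2 y1 = 0" "cinner x2 y2 = 0"
  shows "spread_le (sym_op x1 y1 + sym_op x2 y2) 2" "spread_le (sym_op x1 y1 - sym_op x2 y2) 2"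
proof -
  have bound: "\<bar>sym_op x1 y1 u \<bullet> u\<bar> + \<bar>sym_op x2 y2 u \<bullet> u\<bar> \<le> 1" if u: "norm u = 1" for u
  proof -
    have ne: "x1 \<noteq> x2" "y1 \<noteq> y2" "x1 \<noteq> y1" "x1 \<noteq> y2" "x2 \<noteq> y1" "x2 \<noteq> y2"
      using x y xy by (auto simp: orthonormal_pair_def)
    have "(\<Sum>x\<in>{x1, x2, y1, y2}. (cmod (cinner u x))\<^sup>2) \<le> (norm u)\<^sup>2"
      using x y xy xy[THEN cinner_eq_zero_commute[THEN iffD1]]
        cinner_eq_zero_commute[of x1 x2] cinner_eq_zero_commute[of y1 y2]
      by (intro bessel_inequality) (auto simp: orthonormal_pair_def)
    then have "(cmod (cinner u x1))\<^sup>2 + (cmod (cinner u x2))\<^sup>2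
        + (cmod (cinner u y1))\<^sup>2 + (cmod (cinner u y2))\<^sup>2 \<le> 1"
      using ne u by simp
    moreover have "\<bar>sym_op x y u \<bullet> u\<bar> \<le> (cmod (cinner u x))\<^sup>2 + (cmod (cinner u y))\<^sup>2" for x y
      using abs_sym_op_quadratic_form_le[of u x y]
        sum_squares_bound[of "cmod (cinner u x)" "cmod (cinner u y)"] by simp
    ultimately show ?thesis
      using add_mono[of "\<bar>sym_op x1 y1 u \<bullet> u\<bar>" "(cmod (cinner u x1))\<^sup>2 + (cmod (cinner u y1))\<^sup>2"
        "\<bar>sym_op x2 y2 u \<bullet> u\<bar>" "(cmod (cinner u x2))\<^sup>2 + (cmod (cinner u y2))\<^sup>2"]
      by (smt (verit))
  qed
  have "spread_le (sym_op x1 y1 + sym_op x2 y2) (1 - - 1)"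
    using bound
    by (intro spread_le_bounds; simp add: blinfun.add_left inner_add_left del: sym_op_apply)
      (smt (verit))+
  then show "spread_le (sym_op x1 y1 + sym_op x2 y2) 2"
    by simp
  have "spread_le (sym_op x1 y1 - sym_op x2 y2) (1 - - 1)"
    using bound
    by (intro spread_le_bounds; simp add: blinfun.diff_left inner_diff_left del: sym_op_apply)
      (smt (verit))+
  then show "spread_le (sym_op x1 y1 - sym_op x2 y2) 2"
    by simp
qed

lemma not_spread_le_proj:
  assumes "orthonormal_pair e z"
  shows "\<not> spread_le (proj e) 0"
proof
  assume "spread_le (proj e) 0"
  moreover have "proj e e \<bullet> e = 1" "proj e z \<bullet> z = 0"
    using assms cinner_eq_zero_commute[of z e] unfolding orthonormal_pair_def proj_apply
    by (simp_all only: proj_quadratic_form) (simp_all add: cinner_self)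
  ultimately show False
    using assms spread_leD[of "proj e" 0 e z] unfolding orthonormal_pair_def by linarith
qed

subsection \<open>Images of rank-one projections\<close>

text \<open>Stated through \<open>spread_le\<close>, the hypothesis passes directly to the inverse
  and to the negative of \<open>\<phi>\<close>.\<close>

locale deviation_preserver =
  fixes \<phi> :: "('a::complex_hilbert_space \<Rightarrow>\<^sub>L 'a) \<Rightarrow> ('a \<Rightarrow>\<^sub>L 'a)"
  assumes bij: "bij_betw \<phi> selfadjoint_ops selfadjoint_ops"
    and linear: "real_linear_on selfadjoint_ops \<phi>"
    and spread: "A \<in> selfadjoint_ops \<Longrightarrow> spread_le (\<phi> A) r \<longleftrightarrow> spread_le A r"
begin

lemma closed [simp]: "A \<in> selfadjoint_ops \<Longrightarrow> \<phi> A \<in> selfadjoint_ops"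
  using bij by (auto simp: bij_betw_def)

lemma add: "A \<in> selfadjoint_ops \<Longrightarrow> B \<in> selfadjoint_ops \<Longrightarrow> \<phi> (A + B) = \<phi> A + \<phi> B"
  and scaleR: "A \<in> selfadjoint_ops \<Longrightarrow> \<phi> (r *\<^sub>R A) = r *\<^sub>R \<phi> A"
  using linear by (auto simp: real_linear_on_def)

lemma minus: "A \<in> selfadjoint_ops \<Longrightarrow> \<phi> (- A) = - \<phi> A"
  using scaleR[of A "-1"] by simp

lemma diff: "A \<in> selfadjoint_ops \<Longrightarrow> B \<in> selfadjoint_ops \<Longrightarrow> \<phi> (A - B) = \<phi> A - \<phi> B"
  using add[of A "-B"] minus[of B] by simp

text \<open>Linear maps preserving oscillations send scalars to operators of oscillation 0, hence to
  scalars. So \<open>\<phi>\<close> descends to the quotient.\<close>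

lemma cong:
  assumes "A \<doteq> B" "B \<in> selfadjoint_ops"
  shows "\<phi> A \<doteq> \<phi> B"
proof -
  have A: "A \<in> selfadjoint_ops"
    using assms by (rule scalar_equiv_selfadjoint)
  obtain c where "A = B + c *\<^sub>R id_blinfun"
    using assms(1) by (auto simp: scalar_equiv_def)
  then have "spread_le (A - B) 0"
    by (auto simp: spread_le_def blinfun.scaleR_left norm_eq_1)
  then have "\<phi> A - \<phi> B \<doteq> 0"
    using spread[of "A - B" 0] A assms(2) by (intro spread_le_zero_imp_scalar) (simp_all add: diff)
  then show ?thesis
    using scalar_equiv_add[of "\<phi> A - \<phi> B" 0 "\<phi> B" "\<phi> B"] by simp
qed

text \<open>Reduces the case of a projection sent to minus a rank-one projection to the case of the
  positive sign.\<close>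

lemma negated: "deviation_preserver (\<lambda>A. - \<phi> A)"
proof
  have "bij_betw uminus selfadjoint_ops (selfadjoint_ops :: ('a \<Rightarrow>\<^sub>L 'a) set)"
    by (rule bij_betwI[of _ _ _ uminus]) auto
  from bij_betw_trans[OF bij this]
  show "bij_betw (\<lambda>A. - \<phi> A) selfadjoint_ops selfadjoint_ops"
    by (simp add: o_def)
qed (simp_all add: real_linear_on_def add scaleR spread spread_le_minus)

abbreviation \<psi> :: "('a \<Rightarrow>\<^sub>L 'a) \<Rightarrow> ('a \<Rightarrow>\<^sub>L 'a)"
  where "\<psi> \<equiv> the_inv_into selfadjoint_ops \<phi>"

lemma inverse_closed [simp]: "A \<in> selfadjoint_ops \<Longrightarrow> \<psi> A \<in> selfadjoint_ops"
  using bij by (metis bij_betw_def order_refl the_inv_into_into)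

lemma right_inverse [simp]: "A \<in> selfadjoint_ops \<Longrightarrow> \<phi> (\<psi> A) = A"
  using bij by (simp add: bij_betw_def f_the_inv_into_f)

lemma left_inverse [simp]: "A \<in> selfadjoint_ops \<Longrightarrow> \<psi> (\<phi> A) = A"
  using bij by (simp add: bij_betw_def the_inv_into_f_f)

lemma inverse: "deviation_preserver \<psi>"
proof
  show "bij_betw \<psi> selfadjoint_ops selfadjoint_ops"
    using bij by (rule bij_betw_the_inv_into)
  have "\<psi> (A + B) = \<psi> A + \<psi> B" if "A \<in> selfadjoint_ops" "B \<in> selfadjoint_ops" for A B
    using left_inverse[of "\<psi> A + \<psi> B"] that by (simp add: add)
  moreover have "\<psi> (r *\<^sub>R A) = r *\<^sub>R \<psi> A" if "A \<in> selfadjoint_ops" for r A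
    using left_inverse[of "r *\<^sub>R \<psi> A"] that by (simp add: scaleR)
  ultimately show "real_linear_on selfadjoint_ops \<psi>"
    by (simp add: real_linear_on_def)
  show "spread_le (\<psi> A) r \<longleftrightarrow> spread_le A r" if "A \<in> selfadjoint_ops" for A r
    using spread[of "\<psi> A" r] that by simp
qed

lemma offdiagonal_image:
  "P \<in> selfadjoint_ops \<Longrightarrow> B \<in> selfadjoint_ops \<Longrightarrow> offdiagonal P B \<Longrightarrow> offdiagonal (\<phi> P) (\<phi> B)"
  unfolding offdiagonal_def
  using spread[of "_ *\<^sub>R P + B"] spread[of "_ *\<^sub>R P - B"] by (simp add: add diff scaleR)

text \<open>A decomposition that tests extremality of the image is pulled back along
  \<open>\<psi>\<close> to one of \<open>proj e\<close>, which is extreme. The vector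
  \<open>z\<close> shows that the kernel of \<open>proj e\<close> is nontrivial.\<close>

lemma image_proj_projector:
  assumes ez: "orthonormal_pair e z"
  obtains R where "projector R" "\<phi> (proj e) \<doteq> R"
proof (rule extreme_imp_projector)
  interpret inv: deviation_preserver \<psi>
    by (rule inverse)
  have e: "norm e = 1" "norm z = 1" "cinner z e = 0"
    using ez by (simp_all add: orthonormal_pair_def cinner_eq_zero_commute[of z])
  show "\<phi> (proj e) \<in> selfadjoint_ops"
    by simp
  show "spread_le (\<phi> (proj e)) 1"
    using e by (simp add: spread projector_spread projector_proj)
  show "\<not> spread_le (\<phi> (proj e)) 0"
    using not_spread_le_proj[OF ez] by (simp add: spread)
  fix B C
  assume BC: "B \<in> selfadjoint_ops" "C \<in> selfadjoint_ops" "B + C = 2 *\<^sub>R \<phi> (proj e)"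
    "spread_le B 1" "spread_le C 1"
  have "\<psi> B + \<psi> C = 2 *\<^sub>R proj e"
    using BC by (simp add: inv.scaleR flip: inv.add)
  then have "\<psi> B \<doteq> proj e"
    using BC e by (intro projector_extreme[where C = "\<psi> C" and ?x0.0 = e and ?y0.0 = z])
      (simp_all add: projector_proj inv.spread cinner_self scaleC_one)
  then show "B \<doteq> \<phi> (proj e)"
    using cong[of "\<psi> B" "proj e"] BC by simp
qed (rule that)

text \<open>Orthonormal \<open>x\<^sub>1, x\<^sub>2\<close> in the range and \<open>y\<^sub>1, y\<^sub>2\<close> in the kernel of \<open>R\<close> would give off-diagonal
  operators violating the parallelogram law, which holds for those off-diagonal to \<open>proj e\<close>.\<close>

lemma image_proj_rank:
  assumes e: "norm e = 1" and R: "projector R" "\<phi> (proj e) \<doteq> R"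
    and x: "orthonormal_pair x1 x2" "R x1 = x1" "R x2 = x2"
    and y: "orthonormal_pair y1 y2" "R y1 = 0" "R y2 = 0"
  shows False
proof -
  interpret inv: deviation_preserver \<psi>
    by (rule inverse)
  have sa: "R \<in> selfadjoint_ops"
    using R by (simp add: projector_def)
  have R': "\<psi> R \<doteq> proj e"
    using inv.cong[OF R(2) sa] by (simp add: scalar_equiv_sym)
  have xy: "cinner x y = 0" if "R x = x" "R y = 0" for x y
    using selfadjoint_cinner[OF sa, of x y] that by simp
  have pre: "\<exists>z. cinner z e = 0 \<and> \<psi> (sym_op x y) \<doteq> sym_op e z" if "R x = x" "R y = 0" for x y
  proof -
    have "offdiagonal (\<psi> R) (\<psi> (sym_op x y))"
      using sa offdiagonal_sym_op[OF R(1) that] by (intro inv.offdiagonal_image) simp_all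
    then have "offdiagonal (proj e) (\<psi> (sym_op x y))"
      using offdiagonal_cong[OF R' scalar_equiv_refl] by blast
    then show ?thesis
      by (metis offdiagonal_proj_cases[OF e] inverse_closed sym_op_selfadjoint)
  qed
  obtain z1 z2 where z: "cinner z1 e = 0" "\<psi> (sym_op x1 y1) \<doteq> sym_op e z1"
    "cinner z2 e = 0" "\<psi> (sym_op x2 y2) \<doteq> sym_op e z2"
    using pre[OF x(2) y(2)] pre[OF x(3) y(3)] by blast
  \<comment> \<open>For orthonormal \<open>x\<close> and \<open>y\<close> the oscillation of
    \<open>sym_op x y\<close> is 2, and it equals twice the norm of the vector representing the
    preimage.\<close>
  have ge: "1 \<le> norm z"
    if "orthonormal_pair x y" "cinner z e = 0" "\<psi> (sym_op x y) \<doteq> sym_op e z" for x y z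
  proof -
    have "spread_le (sym_op e z) (2 * norm z)"
      using sym_op_spread_iff[OF e that(2)] by simp
    then have "spread_le (sym_op x y) (2 * norm z)"
      using spread_le_cong[OF that(3)] by (simp add: inv.spread)
    then show ?thesis
      using that(1) sym_op_spread_iff[of x y "2 * norm z"]
      by (simp add: orthonormal_pair_def cinner_eq_zero_commute[of x])
  qed
  have "orthonormal_pair x1 y1" "orthonormal_pair x2 y2"
    using x y xy by (simp_all add: orthonormal_pair_def)
  then have ge': "1 \<le> norm z1" "1 \<le> norm z2"
    using ge z by blast+
  have "\<psi> (sym_op x1 y1 + sym_op x2 y2) \<doteq> sym_op e (z1 + z2)"
    "\<psi> (sym_op x1 y1 - sym_op x2 y2) \<doteq> sym_op e (z1 - z2)"
    using scalar_equiv_add[OF z(2,4)] scalar_equiv_diff[OF z(2,4)]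
    by (simp_all add: inv.add inv.diff sym_op_add_right sym_op_diff_right)
  moreover have "spread_le (\<psi> (sym_op x1 y1 + sym_op x2 y2)) 2"
    "spread_le (\<psi> (sym_op x1 y1 - sym_op x2 y2)) 2"
    using two_sym_ops_spread[OF x(1) y(1)] x y xy by (simp_all add: inv.spread)
  ultimately have "spread_le (sym_op e (z1 + z2)) 2" "spread_le (sym_op e (z1 - z2)) 2"
    by (simp_all add: spread_le_cong)
  then have "norm (z1 + z2) \<le> 1" "norm (z1 - z2) \<le> 1"
    using sym_op_spread_iff[OF e] z by (simp_all add: cinner_bilinear)
  then have "(norm (z1 + z2))\<^sup>2 \<le> 1" "(norm (z1 - z2))\<^sup>2 \<le> 1"
    by (simp_all add: power_le_one)
  moreover have "(norm (z1 + z2))\<^sup>2 + (norm (z1 - z2))\<^sup>2 = 2 * (norm z1)\<^sup>2 + 2 * (norm z2)\<^sup>2"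
    by (simp add: power2_norm_eq_inner inner_add_left inner_add_right inner_diff_left
        inner_diff_right)
  moreover have "1 \<le> (norm z1)\<^sup>2" "1 \<le> (norm z2)\<^sup>2"
    using ge' by (simp_all add: one_le_power)
  ultimately show False
    by linarith
qed

text \<open>By \<open>image_proj_rank\<close> the range or the kernel of the projection contains no
  orthonormal pair, and is thus one-dimensional. If it is the kernel, the projection is the identity
  minus \<open>proj w\<close>. The second case also records two vectors that together with
  \<open>w\<close> form an orthonormal triple; they later help to rule out unwanted signs.\<close>

lemma image_proj_cases:
  assumes ez: "orthonormal_pair e z"
  obtains w where "norm w = 1" "\<phi> (proj e) \<doteq> proj w"
  | w x1 x2 where "norm w = 1" "\<phi> (proj e) \<doteq> - proj w"
      "orthonormal_pair x1 x2" "cinner x1 w = 0" "cinner x2 w = 0"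
proof -
  have e: "norm e = 1" "norm z = 1" "cinner z e = 0"
    using ez by (simp_all add: orthonormal_pair_def cinner_eq_zero_commute[of z])
  obtain R where R: "projector R" "\<phi> (proj e) \<doteq> R"
    using image_proj_projector[OF ez] by blast
  have nsp: "\<not> spread_le R 0"
    using not_spread_le_proj[OF ez] spread_le_cong[OF R(2)] by (simp add: spread)
  then have ne: "R \<noteq> 0" "id_blinfun - R \<noteq> 0"
    by (auto simp: spread_le_def norm_eq_1)
  show ?thesis
  proof (cases "\<exists>x1 x2. orthonormal_pair x1 x2 \<and> R x1 = x1 \<and> R x2 = x2")
    case False
    then obtain w where "norm w = 1" "R = proj w"
      using projector_eq_proj[OF R(1) ne(1)] by blast
    then show ?thesis
      using that(1) R(2) by blast
  next
    case True
    then obtain x1 x2 where x: "orthonormal_pair x1 x2" "R x1 = x1" "R x2 = x2"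
      by blast
    have "(id_blinfun - R) y2 \<noteq> y2" if "orthonormal_pair y1 y2" "(id_blinfun - R) y1 = y1" for y1 y2
      using image_proj_rank[OF e(1) R x that(1)] that(2) by (auto simp: blinfun.diff_left)
    then obtain w where w: "norm w = 1" "id_blinfun - R = proj w"
      using projector_eq_proj[OF projector_complement[OF R(1)] ne(2)] by blast
    then have R_eq: "R = - proj w + 1 *\<^sub>R id_blinfun"
      using w(2)[symmetric] by simp
    have "proj w x1 = 0" "proj w x2 = 0"
      using w(2)[symmetric] x by (simp_all add: blinfun.diff_left del: proj_apply)
    moreover have "cinner x w = 0" if "proj w x = 0" for x
      using arg_cong[OF that, of norm] w(1) by simp
    ultimately have "cinner x1 w = 0" "cinner x2 w = 0"
      by blast+
    moreover have "\<phi> (proj e) \<doteq> - proj w"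
      using R(2) scalar_equivI[OF R_eq] scalar_equiv_trans by blast
    ultimately show ?thesis
      using that(2) w(1) x(1) by blast
  qed
qed

end

section \<open>Sums and differences of rank-one projections\<close>

lemma proj_scaleC: "proj (c *\<^sub>C x) = (cmod c)\<^sup>2 *\<^sub>R proj x"
proof (rule blinfun_eqI)
  fix u :: 'a
  have "proj (c *\<^sub>C x) u = (c * cnj c * cinner u x) *\<^sub>C x"
    by (simp add: cinner_scaleC_right scaleC_scaleC mult_ac)
  also have "\<dots> = (complex_of_real ((cmod c)\<^sup>2) * cinner u x) *\<^sub>C x"
    by (simp only: complex_norm_square)
  also have "\<dots> = ((cmod c)\<^sup>2 *\<^sub>R proj x) u"
    by (simp add: blinfun.scaleR_left scaleR_eq_scaleC scaleC_scaleC)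
  finally show "proj (c *\<^sub>C x) u = ((cmod c)\<^sup>2 *\<^sub>R proj x) u" .
qed

lemma proj_scaleR: "proj (r *\<^sub>R x) = r\<^sup>2 *\<^sub>R proj x"
  using proj_scaleC[of "complex_of_real r" x] by (simp add: scaleR_eq_scaleC)

lemma proj_add: "proj (x + y) = proj x + proj y + sym_op x y"
  by (intro blinfun_eqI) (simp add: blinfun.add_left cinner_add_right scaleC_add_left scaleC_add_right)

lemma proj_zero [simp]: "proj 0 = 0"
  by (intro blinfun_eqI) simp

lemma sym_op_scaleR_left: "sym_op (r *\<^sub>R x) y = r *\<^sub>R sym_op x y"
  using sym_op_scaleR_right[of y r x] by (simp add: sym_op_def add.commute)

text \<open>Equality in the Cauchy-Schwarz inequality: \<open>b\<close> has no component orthogonal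
  to \<open>a\<close>, so it is a phase times \<open>a\<close>.\<close>

lemma proj_eq_if_parallel:
  assumes a: "norm a = 1" and b: "norm b = 1" and ge: "1 \<le> cmod (cinner b a)"
  shows "proj b = proj a"
proof -
  have "1 \<le> (cmod (cinner b a))\<^sup>2"
    using ge by (simp add: one_le_power)
  then have "(norm (b - cinner b a *\<^sub>C a))\<^sup>2 \<le> 0"
    using norm_diff_component(2)[OF a, of b] b by simp
  then have b_eq: "b = cinner b a *\<^sub>C a"
    by simp
  then have "cmod (cinner b a) = 1"
    using a b by (metis norm_scaleC mult.right_neutral)
  then show ?thesis
    using b_eq proj_scaleC[of "cinner b a" a] by simp
qed

text \<open>With \<open>S\<close> the sum, q its form at a unit vector \<open>u\<close> and p the
  overlap of \<open>a\<close> and \<open>b\<close>, expanding the squared norm of \<open>S u\<close>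
  bounds it by q (1 + p), while Cauchy-Schwarz gives q^2 as a lower bound. Division by q yields the
  upper bound 1 + p; the lower bound is 0.\<close>

lemma proj_sum_spread:
  assumes a: "norm a = 1" and b: "norm b = 1"
  shows "spread_le (proj a + proj b) (1 + cmod (cinner a b))"
proof -
  define p where "p = cmod (cinner a b)"
  define S where "S = proj a + proj b"
  have S: "S u \<bullet> u = (cmod (cinner u a))\<^sup>2 + (cmod (cinner u b))\<^sup>2" for u
    by (simp add: S_def blinfun.add_left inner_add_left proj_quadratic_form)
  have "S u \<bullet> u \<le> 1 + p" if u: "norm u = 1" for u
  proof -
    define x y where "x = cmod (cinner u a)" and "y = cmod (cinner u b)"
    have "\<bar>(cinner u a *\<^sub>C a) \<bullet> (cinner u b *\<^sub>C b)\<bar> \<le> x * y * p"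
      using abs_Re_le_cmod[of "cinner u a * (cnj (cinner u b) * cinner a b)"]
      by (simp add: x_def y_def p_def inner_eq_Re_cinner cinner_bilinear norm_mult mult_ac)
    then have "(norm (S u))\<^sup>2 \<le> x\<^sup>2 + y\<^sup>2 + 2 * (x * y * p)"
      using a b
      by (simp add: S_def blinfun.add_left power2_norm_eq_inner inner_add_left inner_add_right
          inner_commute x_def y_def norm_eq_1)
        (simp add: power2_norm_eq_inner[symmetric] norm_eq_1[symmetric] power_mult_distrib)
    also have "2 * (x * y * p) \<le> (x\<^sup>2 + y\<^sup>2) * p"
      using mult_right_mono[OF sum_squares_bound[of x y], of p] by (simp add: p_def mult_ac)
    also have "x\<^sup>2 + y\<^sup>2 = S u \<bullet> u"
      by (simp add: S x_def y_def)
    finally have le: "(norm (S u))\<^sup>2 \<le> (S u \<bullet> u) * (1 + p)"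
      by (simp add: algebra_simps)
    have "S u \<bullet> u \<le> norm (S u)"
      using norm_cauchy_schwarz[of "S u" u] u by simp
    moreover have "0 \<le> S u \<bullet> u"
      by (simp add: S)
    ultimately have "(S u \<bullet> u)\<^sup>2 \<le> (norm (S u))\<^sup>2"
      by (rule power_mono)
    then have "(S u \<bullet> u) * (S u \<bullet> u) \<le> (S u \<bullet> u) * (1 + p)"
      using le by (simp add: power2_eq_square)
    moreover have "0 \<le> 1 + p"
      by (simp add: p_def)
    ultimately show ?thesis
      using \<open>0 \<le> S u \<bullet> u\<close> by (cases "S u \<bullet> u = 0") (auto simp: mult_le_cancel_left)
  qed
  then have "spread_le S (1 + p - 0)"
    by (intro spread_le_bounds) (simp_all add: S)
  then show ?thesis
    by (simp add: S_def p_def)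
qed

text \<open>The exact value 2 sqrt(1 - p^2) for overlap p is replaced by a rational bound that is
  still below 2 unless p = 0. It follows by splitting off from \<open>u\<close> its component along
  \<open>a\<close>.\<close>

lemma proj_diff_spread:
  assumes a: "norm a = 1" and b: "norm b = 1"
  shows "spread_le (proj a - proj b) (2 / (1 + (cmod (cinner a b))\<^sup>2 / 2))"
proof -
  have bound: "(cmod (cinner u a))\<^sup>2 - (cmod (cinner u b))\<^sup>2 \<le> 1 / (1 + (cmod (cinner a b))\<^sup>2 / 2)"
    if a: "norm a = 1" and b: "norm b = 1" and u: "norm u = 1" for u a b :: 'a
  proof -
    define x y p where "x = cmod (cinner u a)" and "y = cmod (cinner u b)"
      and "p = cmod (cinner a b)"
    define v where "v = u - cinner u a *\<^sub>C a"
    have v: "(norm v)\<^sup>2 = 1 - x\<^sup>2"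
      using norm_diff_component(2)[OF a, of u] u by (simp add: v_def x_def)
    have "cinner u a * cinner a b = cinner u b - cinner v b"
      by (simp add: v_def cinner_bilinear)
    then have "x * p \<le> y + cmod (cinner v b)"
      unfolding x_def y_def p_def norm_mult[symmetric] by (simp add: norm_triangle_ineq4)
    also have "\<dots> \<le> y + norm v"
      using cmod_cinner_le[of v b] b by simp
    finally have "(x * p)\<^sup>2 \<le> (y + norm v)\<^sup>2"
      by (intro power_mono) (simp_all add: x_def p_def)
    also have "\<dots> \<le> 2 * (y\<^sup>2 + (norm v)\<^sup>2)"
      using sum_squares_bound[of y "norm v"] by (simp add: power2_sum)
    finally have "p\<^sup>2 * x\<^sup>2 \<le> 2 * (y\<^sup>2 + 1 - x\<^sup>2)"
      by (simp add: v power_mult_distrib mult.commute)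
    moreover define d where "d = x\<^sup>2 - y\<^sup>2"
    moreover have "p\<^sup>2 * d \<le> p\<^sup>2 * x\<^sup>2"
      by (intro mult_left_mono) (simp_all add: d_def)
    ultimately have "p\<^sup>2 * d \<le> 2 * (1 - d)"
      by simp
    then have "d * (1 + p\<^sup>2 / 2) \<le> 1"
      by (simp add: field_simps)
    moreover have "0 < 1 + p\<^sup>2 / 2"
      by (simp add: add_pos_nonneg)
    ultimately show ?thesis
      unfolding x_def[symmetric] y_def[symmetric] p_def[symmetric] d_def[symmetric]
      by (simp only: pos_le_divide_eq)
  qed
  define r where "r = 1 / (1 + (cmod (cinner a b))\<^sup>2 / 2)"
  have "spread_le (proj a - proj b) (r - - r)"
  proof (rule spread_le_bounds)
    fix u :: 'a
    assume u: "norm u = 1"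
    show "- r \<le> (proj a - proj b) u \<bullet> u"
      using bound[OF b a u] cmod_cinner_commute[of a b]
      by (simp add: blinfun.diff_left inner_diff_left proj_quadratic_form r_def)
    show "(proj a - proj b) u \<bullet> u \<le> r"
      using bound[OF a b u] by (simp add: blinfun.diff_left inner_diff_left proj_quadratic_form r_def)
  qed
  then show ?thesis
    by (simp add: r_def)
qed

lemma orthonormal_proj_diff_spread:
  assumes "orthonormal_pair a b" "spread_le (proj a - proj b) r"
  shows "2 \<le> r"
proof -
  have ab: "norm a = 1" "norm b = 1" "cinner a b = 0" "cinner b a = 0"
    using assms(1) cinner_eq_zero_commute[of a b] by (simp_all add: orthonormal_pair_def)
  then have "cinner a a = 1" "cinner b b = 1" "a \<bullet> a = 1" "b \<bullet> b = 1"
    by (simp_all add: cinner_self flip: norm_eq_1)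
  then show ?thesis
    using spread_leD[OF assms(2) ab(1,2)] ab(3,4)
    by (simp add: blinfun.diff_left inner_diff_left scaleC_one)
qed

text \<open>A trace count: evaluation at \<open>e\<close> shows that the scalar would be 1, so the
  forms at the orthonormal triple would add up to 3, while Bessel for \<open>e\<close> and
  \<open>z\<close> allows at most 2.\<close>

lemma proj_sum_not_scalar:
  fixes e z x1 x2 x3 :: "'a::complex_hilbert_space"
  assumes ez: "orthonormal_pair e z" and "orthonormal_pair x1 x2"
    and "norm x3 = 1" "cinner x1 x3 = 0" "cinner x2 x3 = 0"
  shows "\<not> proj e + proj z \<doteq> 0"
proof
  assume "proj e + proj z \<doteq> 0"
  then obtain c where c: "proj e + proj z = c *\<^sub>R id_blinfun"
    by (auto simp: scalar_equiv_def)
  have e: "norm e = 1" "norm z = 1" "cinner e z = 0"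
    using ez by (simp_all add: orthonormal_pair_def)
  have q: "(cmod (cinner u e))\<^sup>2 + (cmod (cinner u z))\<^sup>2 = c * (norm u)\<^sup>2" for u
    using arg_cong[OF c, of "\<lambda>T. T u \<bullet> u"]
    by (simp add: blinfun.add_left blinfun.scaleR_left inner_add_left proj_quadratic_form
        power2_norm_eq_inner)
  have "c = 1"
    using q[of e] e by (simp add: cinner_self)
  define X where "X = {x1, x2, x3}"
  have X: "norm x = 1" if "x \<in> X" for x
    using assms that by (auto simp: X_def orthonormal_pair_def)
  have "cinner x y = 0" if "x \<in> X" "y \<in> X" "x \<noteq> y" for x y
    using assms that cinner_eq_zero_commute[of x1 x2] cinner_eq_zero_commute[of x1 x3]
      cinner_eq_zero_commute[of x2 x3]
    by (auto simp: X_def orthonormal_pair_def)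
  then have bessel: "(\<Sum>x\<in>X. (cmod (cinner u x))\<^sup>2) \<le> (norm u)\<^sup>2" for u
    using X by (intro bessel_inequality) (auto simp: X_def)
  have "x1 \<noteq> x2" "x1 \<noteq> x3" "x2 \<noteq> x3"
    using assms by (auto simp: orthonormal_pair_def)
  then have "3 = (\<Sum>x\<in>X. 1 :: real)"
    by (simp add: X_def)
  also have "\<dots> = (\<Sum>x\<in>X. (cmod (cinner e x))\<^sup>2) + (\<Sum>x\<in>X. (cmod (cinner z x))\<^sup>2)"
    unfolding sum.distrib[symmetric]
  proof (intro sum.cong refl)
    show "1 = (cmod (cinner e x))\<^sup>2 + (cmod (cinner z x))\<^sup>2" if "x \<in> X" for x
      using q[of x] X[OF that] \<open>c = 1\<close> by (simp add: cmod_cinner_commute[of x])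
  qed
  also have "\<dots> \<le> 2"
    using bessel[of e] bessel[of z] e by simp
  finally show False
    by simp
qed

subsection \<open>The implementing operator\<close>

locale deviation_preserver_at = deviation_preserver +
  fixes e e' :: 'a
  assumes unit: "norm e = 1" "norm e' = 1" and image: "\<phi> (proj e) \<doteq> proj e'"
begin

lemma inverse_at: "deviation_preserver_at \<psi> e' e"
proof -
  interpret inv: deviation_preserver \<psi>
    by (rule inverse)
  have "\<psi> (proj e') \<doteq> proj e"
    using inv.cong[OF image] by (simp add: scalar_equiv_sym)
  then show ?thesis
    using unit inverse by (simp add: deviation_preserver_at_def deviation_preserver_at_axioms_def)
qed

text \<open>The choice is unique for \<open>z\<close> orthogonal to \<open>e\<close>, by
  \<open>sym_op_equiv_cancel\<close>; \<open>W\<close> is only applied to such vectors.\<close>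

definition W :: "'a \<Rightarrow> 'a"
  where "W z = (SOME w. cinner w e' = 0 \<and> \<phi> (sym_op e z) \<doteq> sym_op e' w)"

lemma W_exists:
  assumes "cinner z e = 0"
  shows "\<exists>w. cinner w e' = 0 \<and> \<phi> (sym_op e z) \<doteq> sym_op e' w"
proof -
  have "offdiagonal (proj e') (\<phi> (sym_op e z))"
    using offdiagonal_image[OF _ _ proj_offdiagonal_sym_op[OF unit(1) assms]]
      offdiagonal_cong[OF image scalar_equiv_refl] by simp
  then show ?thesis
    by (metis offdiagonal_proj_cases[OF unit(2)] closed sym_op_selfadjoint)
qed

lemma W:
  assumes "cinner z e = 0"
  shows "cinner (W z) e' = 0" "\<phi> (sym_op e z) \<doteq> sym_op e' (W z)"
  using someI_ex[OF W_exists[OF assms]] by (simp_all add: W_def)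

lemma W_unique:
  assumes "cinner z e = 0" "cinner w e' = 0" "\<phi> (sym_op e z) \<doteq> sym_op e' w"
  shows "W z = w"
  using assms W[OF assms(1)] scalar_equiv_trans[OF scalar_equiv_sym[OF W(2)[OF assms(1)]] assms(3)]
  by (intro sym_op_equiv_cancel[OF unit(2)])

lemma W_add:
  assumes "cinner x e = 0" "cinner y e = 0"
  shows "W (x + y) = W x + W y"
  using assms W[of x] W[of y]
  by (intro W_unique) (simp_all add: cinner_add_left sym_op_add_right add scalar_equiv_add)

lemma W_scaleR:
  assumes "cinner x e = 0"
  shows "W (r *\<^sub>R x) = r *\<^sub>R W x"
  using assms W[of x]
  by (intro W_unique) (simp_all add: sym_op_scaleR_right scaleR scalar_equiv_scaleR)

lemma norm_W:
  assumes "cinner x e = 0"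
  shows "norm (W x) = norm x"
proof -
  have "2 * norm (W x) \<le> r \<longleftrightarrow> 2 * norm x \<le> r" for r
    using sym_op_spread_iff[OF unit(1) assms, of r] sym_op_spread_iff[OF unit(2) W(1)[OF assms], of r]
      spread_le_cong[OF W(2)[OF assms], of r] spread[of "sym_op e x" r] by simp
  from this[of "2 * norm x"] this[of "2 * norm (W x)"] show ?thesis
    by simp
qed

text \<open>The preimage is the vector that the inverse map \<open>\<psi>\<close> assigns to
  \<open>w\<close>, with the roles of \<open>e\<close> and \<open>e'\<close> exchanged.\<close>

lemma W_surj:
  assumes "cinner w e' = 0"
  obtains z where "cinner z e = 0" "W z = w"
proof -
  interpret inv: deviation_preserver_at \<psi> e' e
    by (rule inverse_at)
  obtain z where z: "cinner z e = 0" "\<psi> (sym_op e' w) \<doteq> sym_op e z"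
    using inv.W_exists[OF assms] by blast
  have "\<phi> (sym_op e z) \<doteq> sym_op e' w"
    using cong[OF scalar_equiv_sym[OF z(2)]] by simp
  then show ?thesis
    using that W_unique z(1) assms by blast
qed

text \<open>The difference of \<open>proj z\<close> and \<open>proj e\<close> has oscillation 2. If
  the sign of the image of \<open>proj z\<close> is positive, \<open>proj_diff_spread\<close> forces
  \<open>w\<close> to be orthogonal to \<open>e'\<close>. If it is negative,
  \<open>proj_sum_spread\<close> forces \<open>proj w = proj e'\<close>. Then
  \<open>proj e + proj z\<close> is sent to a scalar and is itself a scalar, which the triple
  \<open>x1\<close>, \<open>x2\<close>, \<open>w\<close> excludes.\<close>

lemma image_orthogonal_proj:
  assumes ez: "orthonormal_pair e z"
  obtains w where "norm w = 1" "cinner w e' = 0" "\<phi> (proj z) \<doteq> proj w"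
proof -
  have ze: "orthonormal_pair z e"
    using ez cinner_eq_zero_commute[of e z] by (simp add: orthonormal_pair_def)
  show ?thesis
    using ze
  proof (cases rule: image_proj_cases)
    case (1 w)
    define r where "r = 2 / (1 + (cmod (cinner w e'))\<^sup>2 / 2)"
    have "\<phi> (proj z - proj e) \<doteq> proj w - proj e'"
      using scalar_equiv_diff[OF 1(2) image] by (simp add: diff)
    then have "spread_le (proj z - proj e) r"
      using proj_diff_spread[OF 1(1) unit(2)] spread[of "proj z - proj e" r]
      by (simp add: spread_le_cong r_def)
    then have "2 \<le> r"
      by (rule orthonormal_proj_diff_spread[OF ze])
    moreover have "0 < 1 + (cmod (cinner w e'))\<^sup>2 / 2"
      by (simp add: add_pos_nonneg)
    ultimately have "(cmod (cinner w e'))\<^sup>2 \<le> 0"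
      by (simp add: r_def pos_le_divide_eq)
    then have "cinner w e' = 0"
      by simp
    then show ?thesis
      using 1 that by blast
  next
    case (2 w x1 x2)
    have "\<phi> (proj e - proj z) \<doteq> proj e' + proj w"
      using scalar_equiv_diff[OF image 2(2)] by (simp add: diff)
    then have "spread_le (proj e - proj z) (1 + cmod (cinner e' w))"
      using proj_sum_spread[OF unit(2) 2(1)] spread[of "proj e - proj z"]
      by (simp add: spread_le_cong)
    then have "1 \<le> cmod (cinner e' w)"
      using orthonormal_proj_diff_spread[OF ez] by fastforce
    then have "proj e' = proj w"
      using proj_eq_if_parallel unit(2) 2(1) by blast
    then have "\<phi> (proj e + proj z) \<doteq> 0"
      using scalar_equiv_add[OF image 2(2)] by (simp add: add)
    then have "spread_le (proj e + proj z) 0"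
      using spread[of "proj e + proj z" 0] by (simp add: spread_le_cong) (simp add: spread_le_def)
    then have "proj e + proj z \<doteq> 0"
      by (intro spread_le_zero_imp_scalar) simp_all
    then show ?thesis
      using proj_sum_not_scalar[OF ez 2(3) 2(1) 2(4,5)] by blast
  qed
qed

text \<open>Up to scalars, \<open>\<phi>\<close> sends \<open>proj (e + z)\<close> to a multiple of some \<open>proj y\<close> and also to
  \<open>proj e' + proj w + sym_op e' (W z)\<close>; comparing ranges forces \<open>w\<close> to be parallel to \<open>W z\<close>.\<close>

lemma image_proj_unit:
  assumes z: "norm z = 1" "cinner z e = 0"
  shows "\<phi> (proj z) \<doteq> proj (W z)"
proof -
  have ez: "orthonormal_pair e z"
    using z unit cinner_eq_zero_commute[of e z] by (simp add: orthonormal_pair_def)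
  obtain w where w: "norm w = 1" "cinner w e' = 0" "\<phi> (proj z) \<doteq> proj w"
    by (rule image_orthogonal_proj[OF ez])
  define f where "f = W z"
  have f: "norm f = 1" "cinner f e' = 0" "\<phi> (sym_op e z) \<doteq> sym_op e' f"
    using norm_W W z by (simp_all add: f_def)
  \<comment> \<open>Normalised so that \<open>image_proj_cases\<close> applies; the sign of the
    image is kept as an unspecified real factor \<sigma>.\<close>
  define v where "v = (1 / sqrt 2) *\<^sub>R (e + z)"
  have "\<exists>\<sigma> y. \<phi> (proj v) \<doteq> \<sigma> *\<^sub>R proj y"
    using orthonormal_pair_rotate[OF ez] unfolding v_def[symmetric]
    by (cases rule: image_proj_cases) (metis scaleR_one, metis scaleR_minus1_left)
  then obtain \<sigma> y where "\<phi> (proj v) \<doteq> \<sigma> *\<^sub>R proj y"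
    by blast
  then have "2 *\<^sub>R \<phi> (proj v) \<doteq> (2 * \<sigma>) *\<^sub>R proj y"
    using scalar_equiv_scaleR[of "\<phi> (proj v)" "\<sigma> *\<^sub>R proj y" 2] by simp
  moreover have "2 *\<^sub>R proj v = proj e + proj z + sym_op e z"
    by (simp add: v_def proj_scaleR power_divide flip: proj_add)
  then have "2 *\<^sub>R \<phi> (proj v) = \<phi> (proj e) + \<phi> (proj z) + \<phi> (sym_op e z)"
    by (simp flip: scaleR add)
  moreover have "\<phi> (proj e) + \<phi> (proj z) + \<phi> (sym_op e z) \<doteq> proj e' + proj w + sym_op e' f"
    by (intro scalar_equiv_add image w f)
  ultimately have "proj e' + proj w + sym_op e' f \<doteq> (2 * \<sigma>) *\<^sub>R proj y"
    using scalar_equiv_sym scalar_equiv_trans by metis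
  then obtain c where c: "proj e' + proj w + sym_op e' f = (2 * \<sigma>) *\<^sub>R proj y + c *\<^sub>R id_blinfun"
    by (auto simp: scalar_equiv_def)
  have app: "cinner u e' *\<^sub>C e' + cinner u w *\<^sub>C w + (cinner u e' *\<^sub>C f + cinner u f *\<^sub>C e')
      - c *\<^sub>R u = (complex_of_real (2 * \<sigma>) * cinner u y) *\<^sub>C y" for u
    using arg_cong[OF c, of "\<lambda>T. T u"]
    by (simp add: blinfun.add_left blinfun.scaleR_left scaleR_eq_scaleC[of "2 * \<sigma>"] scaleC_scaleC)
  have orth: "cinner w e' = 0" "cinner e' w = 0" "cinner f e' = 0" "cinner e' f = 0"
    using w f cinner_eq_zero_commute[of e'] by auto
  have self: "cinner e' e' = 1" "cinner w w = 1" "cinner f f = 1"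
    using unit w f by (simp_all add: cinner_self)
  have scal: "x - c *\<^sub>R x = complex_of_real (1 - c) *\<^sub>C x" for x :: 'a
    by (simp add: scaleC_diff_left scaleC_one scaleR_eq_scaleC)
  \<comment> \<open>The operator on the right has range in the line through \<open>y\<close>.
    Evaluating at \<open>e'\<close>, \<open>w\<close> and \<open>f\<close> puts three vectors on
    this line.\<close>
  obtain \<alpha> where \<alpha>: "complex_of_real (1 - c) *\<^sub>C e' + f = \<alpha> *\<^sub>C y"
    using app[of e'] unfolding scal[symmetric] by (simp add: orth self scaleC_one algebra_simps)
  obtain \<beta> where \<beta>: "complex_of_real (1 - c) *\<^sub>C w + cinner w f *\<^sub>C e' = \<beta> *\<^sub>C y"
    using app[of w] unfolding scal[symmetric] by (simp add: orth self scaleC_one algebra_simps)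
  obtain \<gamma> where \<gamma>: "e' + cinner f w *\<^sub>C w - c *\<^sub>R f = \<gamma> *\<^sub>C y"
    using app[of f] by (simp add: orth self scaleC_one algebra_simps)
  have "\<alpha> \<noteq> 0"
  proof
    assume "\<alpha> = 0"
    then show False
      using arg_cong[OF \<alpha>, of "\<lambda>x. cinner x f"] by (simp add: cinner_bilinear orth self)
  qed
  have y: "y = (1 / \<alpha>) *\<^sub>C (complex_of_real (1 - c) *\<^sub>C e' + f)"
    unfolding \<alpha> using \<open>\<alpha> \<noteq> 0\<close> by (simp add: scaleC_scaleC scaleC_one)
  \<comment> \<open>Otherwise \<open>y\<close> is a multiple of \<open>f\<close>, so the components
    along \<open>e'\<close> must vanish in the other two equations. The one for \<open>w\<close>
    then gives that \<open>w\<close> and \<open>f\<close> are orthogonal, and the one for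
    \<open>f\<close> has component 1 along \<open>e'\<close>.\<close>
  have "c \<noteq> 1"
  proof
    assume "c = 1"
    then have y': "y = (1 / \<alpha>) *\<^sub>C f"
      using y by simp
    have "cinner w f = 0"
      using arg_cong[OF \<beta>, of "\<lambda>x. cinner x e'"] \<open>c = 1\<close> by (simp add: y' cinner_bilinear orth self)
    then have "cinner f w = 0"
      using cinner_eq_zero_commute by blast
    then show False
      using arg_cong[OF \<gamma>, of "\<lambda>x. cinner x e'"] by (simp add: y' cinner_bilinear orth self)
  qed
  \<comment> \<open>Comparison of the components along \<open>e'\<close>; once they are removed,
    only multiples of \<open>w\<close> and \<open>f\<close> remain.\<close>
  have "cinner w f = \<beta> / \<alpha> * complex_of_real (1 - c)"
    using arg_cong[OF \<beta>, of "\<lambda>x. cinner x e'"] by (simp add: y cinner_bilinear orth self)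
  then have "complex_of_real (1 - c) *\<^sub>C w = (\<beta> / \<alpha>) *\<^sub>C f"
    using \<beta> by (simp add: y scaleC_add_right scaleC_scaleC)
  then have "(1 / complex_of_real (1 - c)) *\<^sub>C (complex_of_real (1 - c) *\<^sub>C w)
      = (1 / complex_of_real (1 - c)) *\<^sub>C ((\<beta> / \<alpha>) *\<^sub>C f)"
    by simp
  moreover have "complex_of_real (1 - c) \<noteq> 0"
    using \<open>c \<noteq> 1\<close> by (metis eq_iff_diff_eq_0 of_real_eq_0_iff)
  ultimately obtain \<mu> where \<mu>: "w = \<mu> *\<^sub>C f"
    by (auto simp only: scaleC_scaleC) (simp add: scaleC_one)
  then have "cmod \<mu> = 1"
    using w(1) f(1) by simp
  then have "proj w = proj f"
    by (simp add: \<mu> proj_scaleC)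
  then show ?thesis
    using w(3) by (simp add: f_def)
qed

lemma image_proj_orthogonal:
  assumes z: "cinner z e = 0"
  shows "\<phi> (proj z) \<doteq> proj (W z)"
proof (cases "z = 0")
  case True
  then show ?thesis
    using norm_W[of 0] scaleR[of 0 0] by simp
next
  case False
  define y where "y = (1 / norm z) *\<^sub>R z"
  have y: "norm y = 1" "cinner y e = 0" "z = norm z *\<^sub>R y"
    using z False by (simp_all add: y_def)
  have "(norm z)\<^sup>2 *\<^sub>R \<phi> (proj y) \<doteq> (norm z)\<^sup>2 *\<^sub>R proj (W y)"
    by (intro scalar_equiv_scaleR image_proj_unit y)
  moreover have "proj z = (norm z)\<^sup>2 *\<^sub>R proj y" "proj (W z) = (norm z)\<^sup>2 *\<^sub>R proj (W y)"
    using y W_scaleR[of y "norm z"] proj_scaleR[of "norm z"] by metis+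
  ultimately show ?thesis
    by (simp add: scaleR)
qed

text \<open>Expansion of the projection into its diagonal and off-diagonal parts. The coefficient
  \<open>a\<close> is real because only real linearity of \<open>W\<close> is available at this
  point.\<close>

lemma image_proj_real_combination:
  assumes z: "cinner z e = 0"
  shows "\<phi> (proj (a *\<^sub>R e + z)) \<doteq> proj (a *\<^sub>R e' + W z)"
proof -
  have "a\<^sup>2 *\<^sub>R \<phi> (proj e) + \<phi> (proj z) + a *\<^sub>R \<phi> (sym_op e z)
      \<doteq> a\<^sup>2 *\<^sub>R proj e' + proj (W z) + a *\<^sub>R sym_op e' (W z)"
    by (intro scalar_equiv_add scalar_equiv_scaleR image image_proj_orthogonal W z)
  then show ?thesis
    by (simp add: proj_add proj_scaleR sym_op_scaleR_left add scaleR)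
qed

text \<open>The vectors \<open>z\<close> and \<open>\<i> *\<^sub>C z\<close> span the same line,
  hence so do their images. Since \<open>W\<close> is a real isometry, the images are also
  orthogonal for the real inner product, which leaves only the two factors \<i> and -\<i>.\<close>

lemma W_i_cases:
  assumes z: "cinner z e = 0"
  shows "W (\<i> *\<^sub>C z) = \<i> *\<^sub>C W z \<or> W (\<i> *\<^sub>C z) = - (\<i> *\<^sub>C W z)"
proof (cases "z = 0")
  case True
  then show ?thesis
    using norm_W[of 0] by simp
next
  case False
  have iz: "cinner (\<i> *\<^sub>C z) e = 0"
    using z by (simp add: cinner_bilinear)
  define x y where "x = W z" and "y = W (\<i> *\<^sub>C z)"
  have xy: "cinner x e' = 0" "cinner y e' = 0" "norm x = norm z" "norm y = norm z"
    using W norm_W z iz by (simp_all add: x_def y_def)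
  have "proj (\<i> *\<^sub>C z) = proj z"
    by (simp add: proj_scaleC)
  then have "proj y \<doteq> proj x"
    using image_proj_orthogonal[OF iz] image_proj_orthogonal[OF z]
    unfolding x_def y_def by (metis scalar_equiv_sym scalar_equiv_trans)
  then obtain c where c: "proj y = proj x + c *\<^sub>R id_blinfun"
    by (auto simp: scalar_equiv_def)
  \<comment> \<open>Both projections annihilate \<open>e'\<close>, so evaluation there removes the
    scalar.\<close>
  have "c *\<^sub>R e' = 0"
    using arg_cong[OF c, of "\<lambda>T. T e'"] xy cinner_eq_zero_commute[of e' x]
      cinner_eq_zero_commute[of e' y]
    by (simp add: blinfun.add_left blinfun.scaleR_left)
  then have "c = 0"
    using unit(2) by auto
  then have eq: "cinner x y *\<^sub>C y = complex_of_real ((norm z)\<^sup>2) *\<^sub>C x"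
    using arg_cong[OF c, of "\<lambda>T. T x"] by (simp add: cinner_self xy)
  have "(norm (x + y))\<^sup>2 = (norm (z + \<i> *\<^sub>C z))\<^sup>2"
    using norm_W[of "z + \<i> *\<^sub>C z"] W_add[OF z iz] z iz by (simp add: x_def y_def cinner_add_left)
  moreover have "z \<bullet> (\<i> *\<^sub>C z) = 0"
    by (simp add: inner_eq_Re_cinner cinner_bilinear cinner_self)
  ultimately have "(norm x)\<^sup>2 + (norm y)\<^sup>2 + 2 * (x \<bullet> y) = 2 * (norm z)\<^sup>2"
    by (simp add: power2_norm_eq_inner inner_add_left inner_add_right inner_commute)
      (simp add: power2_norm_eq_inner[symmetric])
  then have "x \<bullet> y = 0"
    by (simp add: xy)
  then obtain s where s: "cinner x y = \<i> * complex_of_real s"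
    using complex_eq[of "cinner x y"] by (simp add: inner_eq_Re_cinner)
  have "\<bar>s\<bar> * norm z = (norm z)\<^sup>2 * norm z"
    using arg_cong[OF eq, of norm] by (simp add: xy s norm_mult norm_power)
  then have "\<bar>s\<bar> = (norm z)\<^sup>2"
    using False by simp
  then have "s = (norm z)\<^sup>2 \<or> s = - (norm z)\<^sup>2"
    by linarith
  then obtain \<tau> :: complex where \<tau>: "\<tau> = 1 \<or> \<tau> = -1" "cinner x y = \<i> * \<tau> * complex_of_real ((norm z)\<^sup>2)"
    using s by force
  define r where "r = complex_of_real ((norm z)\<^sup>2)"
  have "(1 / r) *\<^sub>C ((\<i> * \<tau> * r) *\<^sub>C y) = (1 / r) *\<^sub>C (r *\<^sub>C x)"
    using eq \<tau>(2) by (simp add: r_def)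
  moreover have "r \<noteq> 0"
    using False by (simp add: r_def)
  ultimately have "x = (\<i> * \<tau>) *\<^sub>C y"
    by (simp add: scaleC_scaleC scaleC_one)
  then have "\<i> *\<^sub>C x = (\<i> * (\<i> * \<tau>)) *\<^sub>C y"
    by (simp add: scaleC_scaleC)
  then have "\<i> *\<^sub>C x = - y \<or> \<i> *\<^sub>C x = y"
    using \<tau>(1) by (auto simp: scaleC_one mult.assoc[symmetric])
  then show ?thesis
    unfolding x_def y_def by (metis minus_minus)
qed

lemma W_semilinear:
  obtains \<kappa> where "\<kappa> = (\<lambda>c. c) \<or> \<kappa> = cnj" "\<And>c z. cinner z e = 0 \<Longrightarrow> W (c *\<^sub>C z) = \<kappa> c *\<^sub>C W z"
proof -
  have orth_i: "cinner (\<i> *\<^sub>C z) e = 0" if "cinner z e = 0" for z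
    using that by (simp add: cinner_bilinear)
  have dich: "(\<forall>z. cinner z e = 0 \<longrightarrow> W (\<i> *\<^sub>C z) = \<i> *\<^sub>C W z) \<or>
      (\<forall>z. cinner z e = 0 \<longrightarrow> W (\<i> *\<^sub>C z) = - (\<i> *\<^sub>C W z))"
  proof (rule ccontr)
    assume "\<not> ?thesis"
    then obtain y z where y: "cinner y e = 0" "W (\<i> *\<^sub>C y) \<noteq> \<i> *\<^sub>C W y"
      and z: "cinner z e = 0" "W (\<i> *\<^sub>C z) \<noteq> - (\<i> *\<^sub>C W z)"
      by blast
    have yz: "W (\<i> *\<^sub>C y) = - (\<i> *\<^sub>C W y)" "W (\<i> *\<^sub>C z) = \<i> *\<^sub>C W z"
      using W_i_cases y z by blast+
    then have "\<i> *\<^sub>C W y \<noteq> 0" "\<i> *\<^sub>C W z \<noteq> 0"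
      using y z by auto
    moreover have "W (\<i> *\<^sub>C (y + z)) = \<i> *\<^sub>C W z - \<i> *\<^sub>C W y"
      using W_add[OF orth_i[OF y(1)] orth_i[OF z(1)]] yz by (simp add: scaleC_add_right)
    moreover have "\<i> *\<^sub>C W (y + z) = \<i> *\<^sub>C W z + \<i> *\<^sub>C W y"
      using W_add[OF y(1) z(1)] by (simp add: scaleC_add_right add.commute)
    moreover have "a = 0 \<or> b = 0" if "b - a = b + a \<or> b - a = - (b + a)" for a b :: 'a
      using that by (auto simp: algebra_simps simp flip: scaleR_2)
    ultimately show False
      using W_i_cases[of "y + z"] y z by (simp add: cinner_add_left) metis
  qed
  have lin: "W (c *\<^sub>C z) = Re c *\<^sub>R W z + Im c *\<^sub>R W (\<i> *\<^sub>C z)" if z: "cinner z e = 0" for c z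
  proof -
    have "c *\<^sub>C z = Re c *\<^sub>R z + Im c *\<^sub>R (\<i> *\<^sub>C z)"
      by (simp add: scaleR_eq_scaleC scaleC_scaleC mult.commute[of _ \<i>] complex_eq[symmetric]
          flip: scaleC_add_left)
    then show ?thesis
      using z orth_i[OF z] by (simp add: W_add W_scaleR)
  qed
  show ?thesis
    using dich
  proof
    assume i: "\<forall>z. cinner z e = 0 \<longrightarrow> W (\<i> *\<^sub>C z) = \<i> *\<^sub>C W z"
    have "W (c *\<^sub>C z) = c *\<^sub>C W z" if z: "cinner z e = 0" for c z
      using lin[OF z, of c] i z
      by (simp add: scaleR_eq_scaleC scaleC_scaleC mult.commute[of _ \<i>] complex_eq[symmetric]
          flip: scaleC_add_left)
    then show ?thesis
      using that[of "\<lambda>c. c"] by blast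
  next
    assume i: "\<forall>z. cinner z e = 0 \<longrightarrow> W (\<i> *\<^sub>C z) = - (\<i> *\<^sub>C W z)"
    have "cnj c = complex_of_real (Re c) - \<i> * complex_of_real (Im c)" for c
      by (simp add: complex_eq_iff)
    then have "W (c *\<^sub>C z) = cnj c *\<^sub>C W z" if z: "cinner z e = 0" for c z
      using lin[OF z, of c] i z
      by (simp add: scaleR_eq_scaleC scaleC_scaleC mult.commute[of _ \<i>] scaleC_diff_left)
    then show ?thesis
      using that[of cnj] by blast
  qed
qed

text \<open>\<open>U\<close> sends \<open>e\<close> to \<open>e'\<close> and acts as
  \<open>W\<close> on the complement of \<open>e\<close>, with \<kappa> applied to the coefficient
  of \<open>e\<close>. As \<kappa> preserves moduli and is its own inverse, \<open>U\<close> is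
  isometric and surjective.\<close>

lemma implementing_operator:
  obtains U where "unitary_op U \<or> antiunitary_op U" "\<And>v. \<phi> (proj v) \<doteq> proj (U v)"
proof -
  obtain \<kappa> where \<kappa>: "\<kappa> = (\<lambda>c. c) \<or> \<kappa> = cnj"
    and W\<kappa>: "\<And>c z. cinner z e = 0 \<Longrightarrow> W (c *\<^sub>C z) = \<kappa> c *\<^sub>C W z"
    using W_semilinear by blast
  have \<kappa>_simps: "\<kappa> (c + d) = \<kappa> c + \<kappa> d" "\<kappa> (c * d) = \<kappa> c * \<kappa> d" "cmod (\<kappa> c) = cmod c"
    "\<kappa> (\<kappa> c) = c" "\<kappa> (complex_of_real r) = complex_of_real r" for c d r
    using \<kappa> by auto
  define p where "p v = v - cinner v e *\<^sub>C e" for v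
  have p: "cinner (p v) e = 0" for v
    unfolding p_def by (rule norm_diff_component(1)[OF unit(1)])
  define U where "U v = \<kappa> (cinner v e) *\<^sub>C e' + W (p v)" for v
  have add: "U (x + y) = U x + U y" for x y
  proof -
    have "p (x + y) = p x + p y"
      by (simp add: p_def cinner_add_left scaleC_add_left)
    then show ?thesis
      by (simp add: U_def W_add p cinner_add_left \<kappa>_simps scaleC_add_left)
  qed
  have scale: "U (c *\<^sub>C x) = \<kappa> c *\<^sub>C U x" for c x
  proof -
    have "p (c *\<^sub>C x) = c *\<^sub>C p x"
      by (simp add: p_def cinner_scaleC_left scaleC_diff_right scaleC_scaleC)
    then show ?thesis
      by (simp add: U_def W\<kappa> p cinner_scaleC_left \<kappa>_simps scaleC_add_right scaleC_scaleC)
  qed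
  have norm: "norm (U x) = norm x" for x
  proof -
    have "cinner (\<kappa> (cinner x e) *\<^sub>C e') (W (p x)) = 0"
      using W(1)[OF p, of x] cinner_eq_zero_commute[of e'] by (simp add: cinner_scaleC_left)
    from norm_add_orthogonal[OF this] have "(norm (U x))\<^sup>2 = (cmod (cinner x e))\<^sup>2 + (norm (p x))\<^sup>2"
      by (simp add: U_def norm_W p \<kappa>_simps unit)
    also have "\<dots> = (norm x)\<^sup>2"
      using norm_diff_component(2)[OF unit(1), of x] by (simp add: p_def)
    finally show ?thesis
      by simp
  qed
  have "inj U"
  proof (rule injI)
    fix x y
    assume "U x = U y"
    moreover have "U (x - y) + U y = U x"
      by (simp flip: add)
    ultimately show "x = y"
      using norm[of "x - y"] by simp
  qed
  moreover have "\<exists>v. U v = y" for y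
  proof -
    have "cinner (y - cinner y e' *\<^sub>C e') e' = 0"
      by (rule norm_diff_component(1)[OF unit(2)])
    then obtain z where z: "cinner z e = 0" "W z = y - cinner y e' *\<^sub>C e'"
      by (rule W_surj)
    define v where "v = \<kappa> (cinner y e') *\<^sub>C e + z"
    have "cinner v e = \<kappa> (cinner y e')"
      using z unit by (simp add: v_def cinner_bilinear cinner_self)
    moreover from this have "p v = z"
      by (simp add: p_def v_def)
    ultimately have "U v = y"
      by (simp add: U_def z \<kappa>_simps)
    then show ?thesis ..
  qed
  ultimately have "bij U"
    by (metis bijI surjI surj_def)
  then have "unitary_op U \<or> antiunitary_op U"
    using add scale norm \<kappa> by (auto simp: unitary_op_def antiunitary_op_def)
  moreover have "\<phi> (proj v) \<doteq> proj (U v)" for v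
  proof -
    \<comment> \<open>A phase leaves the projections onto \<open>v\<close> and \<open>U v\<close>
      unchanged and makes the coefficient of \<open>e\<close> real, as
      \<open>image_proj_real_combination\<close> requires.\<close>
    obtain \<theta> where \<theta>: "cmod \<theta> = 1" "cinner (\<theta> *\<^sub>C v) e = complex_of_real (cmod (cinner v e))"
      by (rule exists_phase)
    define a where "a = cmod (cinner v e)"
    define z where "z = p (\<theta> *\<^sub>C v)"
    have "\<theta> *\<^sub>C v = a *\<^sub>R e + z"
      using \<theta>(2) by (simp add: z_def p_def a_def scaleR_eq_scaleC)
    moreover have "U (\<theta> *\<^sub>C v) = a *\<^sub>R e' + W z"
      using \<theta>(2) by (simp add: U_def z_def a_def \<kappa>_simps scaleR_eq_scaleC)
    moreover have "cinner z e = 0"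
      by (simp add: z_def p)
    ultimately have "\<phi> (proj (\<theta> *\<^sub>C v)) \<doteq> proj (U (\<theta> *\<^sub>C v))"
      using image_proj_real_combination[of z a] by simp
    then show ?thesis
      using \<theta>(1) by (simp add: scale proj_scaleC \<kappa>_simps)
  qed
  ultimately show ?thesis
    using that by blast
qed

end

subsection \<open>General observables\<close>

text \<open>An upper bound for the form of \<open>A\<close> plus a large multiple of
  \<open>proj x\<close>: up to an error of order 1/t it is the value at \<open>x\<close>. With
  \<sigma> the length of the component of \<open>u\<close> orthogonal to \<open>x\<close>, the part
  \<open>2 * norm A\<close> of the coefficient absorbs the errors of order \<sigma>^2, and the part
  \<open>t\<close> absorbs the mixed term of order \<sigma>.\<close>

lemma proj_perturbation_upper:
  assumes A: "A \<in> selfadjoint_ops" and x: "norm x = 1" and t: "t > 0" and u: "norm u = 1"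
  shows "A u \<bullet> u + (t + 2 * norm A) * (cmod (cinner u x))\<^sup>2
    \<le> t + 2 * norm A + A x \<bullet> x + (norm A)\<^sup>2 / t"
proof -
  define K where "K = norm A"
  define a where "a = cinner u x"
  define s where "s = u - a *\<^sub>C x"
  define \<sigma> where "\<sigma> = norm s"
  have a: "(cmod a)\<^sup>2 = 1 - \<sigma>\<^sup>2"
    using norm_diff_component(2)[OF x, of u] u by (simp add: a_def s_def \<sigma>_def)
  have a_le: "cmod a \<le> 1"
    using cmod_cinner_le[of u x] x u by (simp add: a_def)
  have q_le: "\<bar>A v \<bullet> w\<bar> \<le> K * norm v * norm w" for v w
    using Cauchy_Schwarz_ineq2[of "A v" w] mult_right_mono[OF norm_blinfun[of A v], of "norm w"]
    by (simp add: K_def)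
  have "cinner (A (a *\<^sub>C x)) (a *\<^sub>C x) = (a * cnj a) * cinner (A x) x"
    by (simp only: selfadjoint_scaleC[OF A] cinner_bilinear mult_ac)
  then have "complex_of_real (A (a *\<^sub>C x) \<bullet> (a *\<^sub>C x)) = complex_of_real ((1 - \<sigma>\<^sup>2) * (A x \<bullet> x))"
    by (simp only: selfadjoint_cinner_self[OF A] complex_norm_square[symmetric] a of_real_mult)
  then have qx: "A (a *\<^sub>C x) \<bullet> (a *\<^sub>C x) = (1 - \<sigma>\<^sup>2) * (A x \<bullet> x)"
    by (simp only: of_real_eq_iff)
  have "u = a *\<^sub>C x + s"
    by (simp add: s_def)
  then have "A u \<bullet> u = (1 - \<sigma>\<^sup>2) * (A x \<bullet> x) + 2 * (A (a *\<^sub>C x) \<bullet> s) + A s \<bullet> s"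
    using selfadjoint_inner[OF A, of s "a *\<^sub>C x"] unfolding qx[symmetric]
    by (simp add: blinfun.add_right inner_add_left inner_add_right inner_commute)
  moreover have "A (a *\<^sub>C x) \<bullet> s \<le> K * \<sigma>"
  proof -
    have "A (a *\<^sub>C x) \<bullet> s \<le> K * cmod a * \<sigma>"
      using q_le[of "a *\<^sub>C x" s] x by (simp add: \<sigma>_def)
    also have "\<dots> \<le> K * 1 * \<sigma>"
      using a_le by (intro mult_right_mono mult_left_mono) (simp_all add: K_def \<sigma>_def)
    finally show ?thesis
      by simp
  qed
  moreover have "A s \<bullet> s \<le> K * \<sigma>\<^sup>2"
    using q_le[of s s] by (simp add: \<sigma>_def power2_eq_square mult.assoc)
  moreover have "- (\<sigma>\<^sup>2 * (A x \<bullet> x)) \<le> \<sigma>\<^sup>2 * K"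
    using q_le[of x x] x mult_left_mono[of "- (A x \<bullet> x)" K "\<sigma>\<^sup>2"] by simp
  ultimately have "A u \<bullet> u \<le> A x \<bullet> x + 2 * (K * \<sigma>) + 2 * (K * \<sigma>\<^sup>2)"
    by (simp add: algebra_simps)
  moreover have "2 * (K * \<sigma>) \<le> t * \<sigma>\<^sup>2 + K\<^sup>2 / t"
  proof -
    have "0 \<le> (t * \<sigma> - K)\<^sup>2 / t"
      using t by simp
    then show ?thesis
      using t by (simp add: power2_diff power_mult_distrib field_simps power2_eq_square)
  qed
  ultimately show ?thesis
    unfolding a_def[symmetric] a K_def[symmetric] by (simp add: algebra_simps)
qed

text \<open>The upper bound applies \<open>proj_perturbation_upper\<close> to \<open>A\<close> at
  \<open>x\<close>, the lower one applies it to \<open>- A\<close> at \<open>y\<close>; in each case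
  the other projection contributes a term of favourable sign.\<close>

lemma proj_perturbation_spread:
  assumes A: "A \<in> selfadjoint_ops" and x: "norm x = 1" and y: "norm y = 1" and t: "t > 0"
  defines "s \<equiv> t + 2 * norm A"
  shows "spread_le (A + s *\<^sub>R (proj x - proj y)) (2 * s + A x \<bullet> x - A y \<bullet> y + 2 * (norm A)\<^sup>2 / t)"
proof -
  have s: "s > 0"
    using t by (simp add: s_def add_pos_nonneg)
  have B: "(A + s *\<^sub>R (proj x - proj y)) u \<bullet> u
      = A u \<bullet> u + s * (cmod (cinner u x))\<^sup>2 - s * (cmod (cinner u y))\<^sup>2" for u
    by (simp add: blinfun.add_left blinfun.diff_left blinfun.scaleR_left inner_add_left
        inner_diff_left proj_quadratic_form algebra_simps)
  have upper: "(A + s *\<^sub>R (proj x - proj y)) u \<bullet> u \<le> s + A x \<bullet> x + (norm A)\<^sup>2 / t"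
    if "norm u = 1" for u
  proof -
    have "0 \<le> s * (cmod (cinner u y))\<^sup>2"
      using s by simp
    then show ?thesis
      using proj_perturbation_upper[OF A x t that] unfolding B s_def[symmetric] by linarith
  qed
  have lower: "- (s - A y \<bullet> y + (norm A)\<^sup>2 / t) \<le> (A + s *\<^sub>R (proj x - proj y)) u \<bullet> u"
    if "norm u = 1" for u
  proof -
    have "0 \<le> s * (cmod (cinner u x))\<^sup>2"
      using s by simp
    moreover have "- (A u \<bullet> u) + s * (cmod (cinner u y))\<^sup>2 \<le> s - A y \<bullet> y + (norm A)\<^sup>2 / t"
      using proj_perturbation_upper[of "- A" y t u] A y t that
      by (simp add: blinfun.minus_left s_def)
    ultimately show ?thesis
      unfolding B by linarith
  qed
  show ?thesis
    using spread_le_bounds[OF lower upper] by (simp add: algebra_simps)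
qed

section \<open>Conjugation by unitary and antiunitary operators\<close>

definition conjugate_op :: "('a::complex_hilbert_space \<Rightarrow> 'a) \<Rightarrow> ('a \<Rightarrow>\<^sub>L 'a) \<Rightarrow> ('a \<Rightarrow>\<^sub>L 'a)"
  where "conjugate_op U A = Blinfun (\<lambda>x. U (A (inv U x)))"

lemma unitary_op_id: "unitary_op (\<lambda>x. x)"
  using bij_id by (simp add: unitary_op_def id_def)

lemma implementing_operator_basics:
  assumes "unitary_op U \<or> antiunitary_op U"
  shows "U (x + y) = U x + U y" "norm (U x) = norm x" "U (r *\<^sub>R x) = r *\<^sub>R U x"
    "U (inv U x) = x" "inv U (U x) = x" "U x \<bullet> U y = x \<bullet> y"
    "cinner x y = 0 \<Longrightarrow> cinner (U x) (U y) = 0"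
proof -
  show *: "U (x + y) = U x + U y" "norm (U x) = norm x" for x y
    using assms by (auto simp: unitary_op_def antiunitary_op_def)
  show "U x \<bullet> U y = x \<bullet> y"
    using * by (rule inner_isometry)
  show "U (r *\<^sub>R x) = r *\<^sub>R U x"
    using assms by (auto simp: unitary_op_def antiunitary_op_def scaleR_eq_scaleC)
  have "bij U"
    using assms by (auto simp: unitary_op_def antiunitary_op_def)
  then show "U (inv U x) = x" and inv: "inv U (U x) = x" for x
    by (simp_all add: bij_is_surj surj_f_inv_f bij_is_inj)
  show "cinner (U x) (U y) = 0" if "cinner x y = 0"
    using assms unitary_op_adjoint[of U x "U y"] antiunitary_op_adjoint[of U x "U y"] that
    by (auto simp: inv)
qed

lemma conjugate_op_apply:
  assumes U: "unitary_op U \<or> antiunitary_op U"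
  shows "conjugate_op U A x = U (A (inv U x))"
proof -
  note basics = implementing_operator_basics[OF U]
  have inv_add: "inv U (x + y) = inv U x + inv U y" for x y
    by (metis basics(1,4,5))
  have inv_scaleR: "inv U (r *\<^sub>R x) = r *\<^sub>R inv U x" for r x
    by (metis basics(3,4,5))
  have inv_norm: "norm (inv U x) = norm x" for x
    by (metis basics(2,4))
  have "bounded_linear (\<lambda>x. U (A (inv U x)))"
  proof (rule bounded_linear_intro[where K = "norm A"])
    show "norm (U (A (inv U x))) \<le> norm x * norm A" for x
      using norm_blinfun[of A "inv U x"] by (simp add: basics(2) inv_norm mult.commute)
  qed (simp_all add: inv_add inv_scaleR blinfun.add_right blinfun.scaleR_right basics)
  then show ?thesis
    by (simp add: conjugate_op_def bounded_linear_Blinfun_apply)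
qed

text \<open>In the antiunitary case the complex conjugations caused by \<open>U\<close> and by its
  inverse cancel.\<close>

lemma conjugate_op_selfadjoint:
  assumes U: "unitary_op U \<or> antiunitary_op U" and A: "A \<in> selfadjoint_ops"
  shows "conjugate_op U A \<in> selfadjoint_ops"
proof -
  note basics = implementing_operator_basics[OF U]
  have "U (A (inv U (c *\<^sub>C x))) = c *\<^sub>C U (A (inv U x)) \<and>
      cinner (U (A (inv U x))) y = cinner x (U (A (inv U y)))" for c x y
    using U
  proof
    assume u: "unitary_op U"
    have "inv U (c *\<^sub>C x) = c *\<^sub>C inv U x"
    proof -
      have "U (c *\<^sub>C inv U x) = c *\<^sub>C x"
        using u by (simp add: unitary_op_def basics(4))
      then show ?thesis
        by (metis basics(5))
    qed
    moreover have "cinner (U (A (inv U x))) y = cinner (inv U x) (A (inv U y))"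
      using unitary_op_adjoint[OF u] selfadjoint_cinner[OF A] by simp
    moreover have "\<dots> = cinner x (U (A (inv U y)))"
      using unitary_op_adjoint[OF u, of "inv U x" "U (A (inv U y))"] by (simp add: basics)
    ultimately show ?thesis
      using u by (simp add: selfadjoint_scaleC[OF A] unitary_op_def)
  next
    assume u: "antiunitary_op U"
    have "inv U (c *\<^sub>C x) = cnj c *\<^sub>C inv U x"
    proof -
      have "U (cnj c *\<^sub>C inv U x) = c *\<^sub>C x"
        using u by (simp add: antiunitary_op_def basics(4))
      then show ?thesis
        by (metis basics(5))
    qed
    moreover have "cinner (U (A (inv U x))) y = cnj (cinner (inv U x) (A (inv U y)))"
      using antiunitary_op_adjoint[OF u] selfadjoint_cinner[OF A] by simp
    moreover have "\<dots> = cinner x (U (A (inv U y)))"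
      using antiunitary_op_adjoint[OF u, of "inv U x" "U (A (inv U y))"] by (simp add: basics)
    ultimately show ?thesis
      using u by (simp add: selfadjoint_scaleC[OF A] antiunitary_op_def)
  qed
  then show ?thesis
    by (simp add: selfadjoint_ops_def conjugate_op_apply[OF U])
qed

text \<open>The oscillation of \<open>A\<close> plus a large multiple of
  \<open>proj x - proj y\<close> is preserved by \<open>\<phi>\<close>. Evaluating the image at
  \<open>U x\<close> and \<open>U y\<close> bounds the difference of the diagonal values of
  \<open>\<phi> A\<close> there by that of \<open>A\<close> at \<open>x\<close> and
  \<open>y\<close>, up to an error of order 1/t. So the form of
  \<open>\<phi> A - conjugate_op U A\<close> does not decrease from the first to the second vector
  of any orthonormal pair, which by exchanging them makes it constant.\<close>

lemma (in deviation_preserver) image_equiv_conjugate_op: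
  assumes U: "unitary_op U \<or> antiunitary_op U" and proj: "\<And>v. \<phi> (proj v) \<doteq> proj (U v)"
    and A: "A \<in> selfadjoint_ops"
  shows "\<phi> A \<doteq> conjugate_op U A"
proof -
  note basics = implementing_operator_basics[OF U]
  note conj_sa = conjugate_op_selfadjoint[OF U A]
  have "(\<phi> A - conjugate_op U A) x' \<bullet> x' - (\<phi> A - conjugate_op U A) y' \<bullet> y' \<le> 0"
    if xy': "orthonormal_pair x' y'" for x' y'
  proof -
    define x y where "x = inv U x'" and "y = inv U y'"
    have xy: "x' = U x" "y' = U y" "norm x = 1" "norm y = 1"
      using xy' basics(2)[of x] basics(2)[of y]
      by (simp_all add: x_def y_def basics orthonormal_pair_def)
    have orth: "cinner (U x) (U y) = 0" "cinner (U y) (U x) = 0"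
      using xy' cinner_eq_zero_commute[of x' y'] by (simp_all add: xy orthonormal_pair_def)
    have self: "cinner (U x) (U x) = 1" "cinner (U y) (U y) = 1"
      "U x \<bullet> U x = 1" "U y \<bullet> U y = 1"
      using xy by (simp_all add: cinner_self basics(2) flip: norm_eq_1)
    define r where "r = (\<phi> A x' \<bullet> x' - A x \<bullet> x) - (\<phi> A y' \<bullet> y' - A y \<bullet> y)"
    have "r \<le> 2 * (norm A)\<^sup>2 / t" if t: "t > 0" for t
    proof -
      define s where "s = t + 2 * norm A"
      have "\<phi> (A + s *\<^sub>R (proj x - proj y)) = \<phi> A + s *\<^sub>R (\<phi> (proj x) - \<phi> (proj y))"
        using A by (simp add: add scaleR diff)
      also have "\<dots> \<doteq> \<phi> A + s *\<^sub>R (proj (U x) - proj (U y))"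
        by (intro scalar_equiv_add scalar_equiv_scaleR scalar_equiv_diff proj scalar_equiv_refl)
      finally have equiv: "\<phi> (A + s *\<^sub>R (proj x - proj y)) \<doteq> \<phi> A + s *\<^sub>R (proj (U x) - proj (U y))" .
      have "spread_le (\<phi> A + s *\<^sub>R (proj (U x) - proj (U y)))
          (2 * s + A x \<bullet> x - A y \<bullet> y + 2 * (norm A)\<^sup>2 / t)"
        using proj_perturbation_spread[OF A xy(3,4) t] spread_le_cong[OF equiv] A
        unfolding s_def[symmetric] by (simp add: spread)
      from spread_leD[OF this, of "U x" "U y"] show ?thesis
        using xy orth self
        by (simp add: basics(2) blinfun.add_left blinfun.diff_left blinfun.scaleR_left
            inner_add_left inner_diff_left r_def scaleC_one)
    qed
    then have "r \<le> 0"
      by (rule le_zero_if_le_inverse)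
    then show ?thesis
      by (simp add: r_def xy blinfun.diff_left inner_diff_left conjugate_op_apply[OF U] basics)
  qed
  then have "spread_le (\<phi> A - conjugate_op U A) 0"
    using A conj_sa by (intro spread_le_of_orthonormal) simp_all
  then have "\<phi> A - conjugate_op U A \<doteq> 0"
    using A conj_sa by (intro spread_le_zero_imp_scalar) simp_all
  then show ?thesis
    using scalar_equiv_add[of "\<phi> A - conjugate_op U A" 0 "conjugate_op U A" "conjugate_op U A"]
    by simp
qed

text \<open>If no unit vector is orthogonal to \<open>e\<close>, the space is one-dimensional and
  all self-adjoint operators are scalars. Otherwise the sign in the image of \<open>proj e\<close>
  decides \<epsilon>.\<close>

lemma (in deviation_preserver) implementation:
  assumes e: "norm (e :: 'a) = 1"
  obtains U \<epsilon> where "unitary_op U \<or> antiunitary_op U" "\<epsilon> = 1 \<or> \<epsilon> = (-1 :: real)"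
    "\<And>A. A \<in> selfadjoint_ops \<Longrightarrow> \<phi> A \<doteq> \<epsilon> *\<^sub>R conjugate_op U A"
proof (cases "\<exists>z. orthonormal_pair e z")
  case False
  have multiple: "\<exists>a. u = a *\<^sub>C e" for u
    using False exists_unit_component[OF e, of u] by metis
  have "\<not> orthonormal_pair x y" for x y :: 'a
  proof -
    obtain a b where "x = a *\<^sub>C e" "y = b *\<^sub>C e"
      using multiple by meson
    then show ?thesis
      using e by (auto simp: orthonormal_pair_def cinner_bilinear cinner_self)
  qed
  then have "spread_le A 0" if "A \<in> selfadjoint_ops" for A :: "'a \<Rightarrow>\<^sub>L 'a"
    using that by (intro spread_le_of_orthonormal) auto
  then have triv: "A \<doteq> 0" if "A \<in> selfadjoint_ops" for A :: "'a \<Rightarrow>\<^sub>L 'a"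
    using that by (intro spread_le_zero_imp_scalar) auto
  have U: "unitary_op (\<lambda>x::'a. x)"
    by (rule unitary_op_id)
  have "\<phi> A \<doteq> 1 *\<^sub>R conjugate_op (\<lambda>x. x) A" if "A \<in> selfadjoint_ops" for A
    using triv[of "\<phi> A"] triv[of "conjugate_op (\<lambda>x. x) A"] that U
    by (simp add: conjugate_op_selfadjoint) (metis scalar_equiv_sym scalar_equiv_trans)
  then show ?thesis
    using that[of "\<lambda>x. x" 1] U by blast
next
  case True
  then obtain z where ez: "orthonormal_pair e z"
    by blast
  from ez show ?thesis
  proof (cases rule: image_proj_cases)
    case (1 w)
    interpret deviation_preserver_at \<phi> e w
      using e 1 by unfold_locales auto
    obtain U where U: "unitary_op U \<or> antiunitary_op U" "\<And>v. \<phi> (proj v) \<doteq> proj (U v)"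
      using implementing_operator by blast
    show ?thesis
      using that[of U 1] U image_equiv_conjugate_op[OF U] by simp
  next
    case (2 w x1 x2)
    interpret neg: deviation_preserver "\<lambda>A. - \<phi> A"
      by (rule negated)
    have "- \<phi> (proj e) \<doteq> proj w"
      using scalar_equiv_minus[OF 2(2)] by simp
    then interpret neg: deviation_preserver_at "\<lambda>A. - \<phi> A" e w
      using e 2 by unfold_locales auto
    obtain U where U: "unitary_op U \<or> antiunitary_op U" "\<And>v. - \<phi> (proj v) \<doteq> proj (U v)"
      using neg.implementing_operator by blast
    show ?thesis
      using that[of U "-1"] U scalar_equiv_minus[OF neg.image_equiv_conjugate_op[OF U]] by simp
  qed
qed

theorem theorem2:
  fixes \<phi> :: "('a::complex_hilbert_space \<Rightarrow>\<^sub>L 'a) \<Rightarrow> ('a \<Rightarrow>\<^sub>L 'a)"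
  assumes "bij_betw \<phi> selfadjoint_ops selfadjoint_ops"
    and "real_linear_on selfadjoint_ops \<phi>"
    and "\<And>A. A \<in> selfadjoint_ops \<Longrightarrow> max_deviation (\<phi> A) = max_deviation A"
  shows "\<exists>(U :: 'a \<Rightarrow> 'a) (f :: ('a \<Rightarrow>\<^sub>L 'a) \<Rightarrow> real).
    (unitary_op U \<or> antiunitary_op U) \<and> real_linear_on selfadjoint_ops f \<and>
    ((\<forall>A\<in>selfadjoint_ops. \<forall>x. \<phi> A x = U (A (inv U x)) + f A *\<^sub>R x) \<or>
     (\<forall>A\<in>selfadjoint_ops. \<forall>x. \<phi> A x = - U (A (inv U x)) + f A *\<^sub>R x))"
proof (cases "\<exists>e::'a. norm e = 1")
  case False
  \<comment> \<open>The zero space is treated separately: there the supremum in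
    \<open>max_deviation\<close> is over the empty set.\<close>
  then have zero: "x = 0" for x :: 'a
    by (metis norm_sgn)
  have "unitary_op (\<lambda>x::'a. x)" "real_linear_on selfadjoint_ops (\<lambda>A::'a \<Rightarrow>\<^sub>L 'a. 0 :: real)"
    by (simp_all add: unitary_op_id real_linear_on_def)
  moreover have "\<phi> A x = A (inv (\<lambda>x. x) x) + 0 *\<^sub>R x" for A x
    by (subst (1 2) zero) simp
  ultimately show ?thesis
    by (intro exI[of _ "\<lambda>x. x"] exI[of _ "\<lambda>A. 0"]) blast
next
  case True
  then obtain e :: 'a where e: "norm e = 1"
    by blast
  have closed: "\<phi> A \<in> selfadjoint_ops" if "A \<in> selfadjoint_ops" for A
    using assms(1) that by (auto simp: bij_betw_def)
  interpret deviation_preserver \<phi>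
  proof
    show "spread_le (\<phi> A) r \<longleftrightarrow> spread_le A r" if "A \<in> selfadjoint_ops" for A r
      using max_deviation_le_iff[OF that e, of "r / 2"]
        max_deviation_le_iff[OF closed[OF that] e, of "r / 2"] assms(3)[OF that] by simp
  qed (rule assms)+
  obtain U \<epsilon> where U: "unitary_op U \<or> antiunitary_op U" and \<epsilon>: "\<epsilon> = 1 \<or> \<epsilon> = (-1 :: real)"
    and equiv: "\<And>A. A \<in> selfadjoint_ops \<Longrightarrow> \<phi> A \<doteq> \<epsilon> *\<^sub>R conjugate_op U A"
    using implementation[OF e] by blast
  note basics = implementing_operator_basics[OF U]
  \<comment> \<open>Reading the scalar off at \<open>e\<close> makes linearity of \<open>f\<close>
    evident, as opposed to choosing a scalar for each \<open>A\<close>.\<close>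
  define f where "f A = (\<phi> A e - \<epsilon> *\<^sub>R U (A (inv U e))) \<bullet> e" for A
  have "real_linear_on selfadjoint_ops f"
    by (simp add: real_linear_on_def f_def add scaleR basics blinfun.add_left blinfun.scaleR_left
        algebra_simps inner_add_left inner_diff_left)
  moreover have form: "\<phi> A x = \<epsilon> *\<^sub>R U (A (inv U x)) + f A *\<^sub>R x" if A: "A \<in> selfadjoint_ops" for A x
  proof -
    obtain c where c: "\<phi> A = \<epsilon> *\<^sub>R conjugate_op U A + c *\<^sub>R id_blinfun"
      using equiv[OF A] by (auto simp: scalar_equiv_def)
    have app: "\<phi> A x = \<epsilon> *\<^sub>R U (A (inv U x)) + c *\<^sub>R x" for x
      by (simp add: c blinfun.add_left blinfun.scaleR_left conjugate_op_apply[OF U])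
    have "f A = c"
      using e by (simp add: f_def app norm_eq_1)
    then show ?thesis
      using app by simp
  qed
  ultimately show ?thesis
    using U \<epsilon> by (intro exI[of _ U] exI[of _ f]) auto
qed

end
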